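(* Let $V$ be a finite-dimensional vector space over a field $\mathbb{F}$ (of arbitrary characteristic), let $H \leq V$ be a hyperplane defined by some $l_H \in V^*$ (that is, $\ker l_H = H$), and let $G \leq \mathrm{GL}(V)$ be a finite group fixing $H$ pointwise. Then: (1) The group $G$ has a polynomial ring of invariants. (2) The Jacobian determinant of $G$ is $J \doteq l_H^{\,m}$, where $m$ is the sum of the exponents of $G$.
   Context: Let $n = \dim V \geq 1$. A subgroup $G \leq \mathrm{GL}(V)$ acts on $V$, hence on $V^*$ and on the polynomial ring $\mathbb{F}[V] = \mathrm{Sym}(V^* )$; $\mathbb{F}[V]^G$ is the ring of invariants. A finite group $G$ has a polynomial ring of invariants if $\mathbb{F}[V]^G = \mathbb{F}[f_1,\ldots,f_n]$ for some algebraically independent homogeneous polynomials $f_1,\ldots,f_n$, called basic invariants. The degrees of basic invariants depend only on $G$, and the integers $\deg f_1 - 1, \ldots, \deg f_n - 1$ are called the exponents of $G$. In this case the Jacobian determinant of $G$ is $J = J(f_1,\ldots,f_n) = \det(\partial f_i/\partial z_j)$, where $\{z_j\}$ is a basis of $V^*$; it is well defined up to a nonzero scalar in $\mathbb{F}$. A hyperplane is a codimension-one linear subspace. The notation $a \doteq b$ means that $a$ and $b$ are equal up to a nonzero constant in $\mathbb{F}$. *)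

theory Defs
  imports
    "HOL-Analysis.Determinants"
    "HOL-Library.Poly_Mapping"
    "HOL-Library.Function_Algebras"
    "HOL-Algebra.Group"
begin

section \<open>Linear groups and the dual space\<close>

text \<open>
  A vector space over a field is given by its scalar multiplication \<open>smul\<close>, as in the
  locale \<^locale>\<open>vector_space\<close>.
\<close>

definition GL :: "('a::field \<Rightarrow> 'v::ab_group_add \<Rightarrow> 'v) \<Rightarrow> ('v \<Rightarrow> 'v) monoid" where
  "GL smul = \<lparr>carrier = {g. Vector_Spaces.linear smul smul g \<and> bij g},
     monoid.mult = (\<circ>), one = id\<rparr>"

definition dual_space :: "('a::field \<Rightarrow> 'v::ab_group_add \<Rightarrow> 'v) \<Rightarrow> ('v \<Rightarrow> 'a) set" where
  "dual_space smul = {\<phi>. Vector_Spaces.linear smul (*) \<phi>}"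

definition fun_scale :: "'a::field \<Rightarrow> ('v \<Rightarrow> 'a) \<Rightarrow> 'v \<Rightarrow> 'a" where
  "fun_scale c \<phi> = (\<lambda>v. c * \<phi> v)"

definition dual_basis ::
  "('a::field \<Rightarrow> 'v::ab_group_add \<Rightarrow> 'v) \<Rightarrow> ('n \<Rightarrow> 'v \<Rightarrow> 'a) \<Rightarrow> bool" where
  "dual_basis smul z \<longleftrightarrow> inj z \<and> \<not> module.dependent fun_scale (range z) \<and>
     module.span fun_scale (range z) = dual_space smul"

definition hyperplane :: "('a::field \<Rightarrow> 'v::ab_group_add \<Rightarrow> 'v) \<Rightarrow> 'v set \<Rightarrow> bool" where
  "hyperplane smul H \<longleftrightarrow> module.subspace smul H \<and>
     vector_space.dim smul H + 1 = vector_space.dim smul UNIV"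


section \<open>Multivariate polynomials\<close>

text \<open>
  Formal polynomials in variables indexed by \<open>'n\<close>: finitely supported maps from
  exponent vectors to coefficients.  They are not identified with functions,
  which matters over finite fields.
\<close>

type_synonym ('n, 'a) mpoly = "('n \<Rightarrow>\<^sub>0 nat) \<Rightarrow>\<^sub>0 'a"

definition Const :: "'a::field \<Rightarrow> ('n, 'a) mpoly" where
  "Const c = Poly_Mapping.single 0 c"

definition Var :: "'n \<Rightarrow> ('n, 'a::field) mpoly" where
  "Var j = Poly_Mapping.single (Poly_Mapping.single j 1) 1"

definition subst_poly ::
  "('n::finite \<Rightarrow> ('m, 'a::field) mpoly) \<Rightarrow> ('n, 'a) mpoly \<Rightarrow> ('m, 'a) mpoly" where
  "subst_poly \<sigma> p =
     (\<Sum>e\<in>Poly_Mapping.keys p.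
        Const (Poly_Mapping.lookup p e) * (\<Prod>i\<in>UNIV. \<sigma> i ^ Poly_Mapping.lookup e i))"

definition partial_deriv ::
  "'n \<Rightarrow> ('n, 'a::field) mpoly \<Rightarrow> ('n, 'a) mpoly" where
  "partial_deriv j p =
     (\<Sum>e\<in>Poly_Mapping.keys p.
        Poly_Mapping.single (e - Poly_Mapping.single j 1)
          (of_nat (Poly_Mapping.lookup e j) * Poly_Mapping.lookup p e))"

definition monom_degree :: "('n::finite \<Rightarrow>\<^sub>0 nat) \<Rightarrow> nat" where
  "monom_degree e = (\<Sum>i\<in>UNIV. Poly_Mapping.lookup e i)"

definition homogeneous :: "('n::finite, 'a::field) mpoly \<Rightarrow> bool" where
  "homogeneous p \<longleftrightarrow> (\<exists>d. \<forall>e\<in>Poly_Mapping.keys p. monom_degree e = d)"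

definition total_degree :: "('n::finite, 'a::field) mpoly \<Rightarrow> nat" where
  "total_degree p = (if p = 0 then 0 else Max (monom_degree ` Poly_Mapping.keys p))"

definition alg_independent :: "('n::finite \<Rightarrow> ('m, 'a::field) mpoly) \<Rightarrow> bool" where
  "alg_independent f \<longleftrightarrow> (\<forall>q :: ('n, 'a) mpoly. subst_poly f q = 0 \<longrightarrow> q = 0)"

definition generated_algebra ::
  "('n::finite \<Rightarrow> ('m, 'a::field) mpoly) \<Rightarrow> ('m, 'a) mpoly set" where
  "generated_algebra f = range (subst_poly f)"

definition eq_up_to_const :: "('n, 'a::field) mpoly \<Rightarrow> ('n, 'a) mpoly \<Rightarrow> bool"
    (infix \<open>\<doteq>\<close> 50) where
  "p \<doteq> q \<longleftrightarrow> (\<exists>c. c \<noteq> 0 \<and> p = Const c * q)"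


section \<open>The symmetric algebra of the dual space and its invariants\<close>

text \<open>
  A basis \<open>z\<close> of the dual space identifies its symmetric algebra with \<open>('n, 'a) mpoly\<close>,
  \<open>Var j\<close> corresponding to \<open>z j\<close>.  Under this identification \<open>linear_form z\<close> is
  the inclusion of the dual space as the forms of degree one.
\<close>

definition linear_form ::
  "('n::finite \<Rightarrow> 'v \<Rightarrow> 'a::field) \<Rightarrow> ('v \<Rightarrow> 'a) \<Rightarrow> ('n, 'a) mpoly" where
  "linear_form z \<phi> =
     (\<Sum>j\<in>UNIV. Const (module.representation fun_scale (range z) \<phi> (z j)) * Var j)"

text \<open>
  The contragredient action \<open>\<phi> \<mapsto> \<phi> \<circ> g\<inverse>\<close>, extended to an algebra automorphism.
  The inverse is written \<^const>\<open>inv_into\<close> because \<open>inv\<close> is group inversion here.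
\<close>

definition act ::
  "('n::finite \<Rightarrow> 'v \<Rightarrow> 'a::field) \<Rightarrow> ('v \<Rightarrow> 'v) \<Rightarrow> ('n, 'a) mpoly \<Rightarrow> ('n, 'a) mpoly" where
  "act z g p = subst_poly (\<lambda>j. linear_form z (z j \<circ> inv_into UNIV g)) p"

definition invariant_ring ::
  "('n::finite \<Rightarrow> 'v \<Rightarrow> 'a::field) \<Rightarrow> ('v \<Rightarrow> 'v) set \<Rightarrow> ('n, 'a) mpoly set" where
  "invariant_ring z G = {p. \<forall>g\<in>G. act z g p = p}"

definition basic_invariants ::
  "('n::finite \<Rightarrow> 'v \<Rightarrow> 'a::field) \<Rightarrow> ('v \<Rightarrow> 'v) set \<Rightarrow> ('n \<Rightarrow> ('n, 'a) mpoly) \<Rightarrow> bool" where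
  "basic_invariants z G f \<longleftrightarrow> alg_independent f \<and> (\<forall>i. homogeneous (f i)) \<and>
     invariant_ring z G = generated_algebra f"

definition has_polynomial_invariants ::
  "('n::finite \<Rightarrow> 'v \<Rightarrow> 'a::field) \<Rightarrow> ('v \<Rightarrow> 'v) set \<Rightarrow> bool" where
  "has_polynomial_invariants z G \<longleftrightarrow> (\<exists>f. basic_invariants z G f)"

text \<open>
  Basic invariants, being algebraically independent, are not constant, so the
  subtraction on natural numbers does not truncate.
\<close>

definition exponent_of :: "('n::finite, 'a::field) mpoly \<Rightarrow> nat" where
  "exponent_of p = total_degree p - 1"

definition jacobian :: "('n::finite \<Rightarrow> ('n, 'a::field) mpoly) \<Rightarrow> ('n, 'a) mpoly" where
  "jacobian f = det (\<chi> i j. partial_deriv j (f i))"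

end

theory Submission
  imports Defs "HOL-Computational_Algebra.Polynomial"
begin

text \<open>
  Fix a vector \<open>v0\<close> with \<open>l v0 = 1\<close>.  A linear map \<open>h\<close> that fixes \<open>H = ker l\<close> pointwise has the form
  \<open>h v = v + l v *s b\<close> with \<open>b = h v0 - v0\<close>, so it sends a form \<open>\<phi>\<close> to \<open>\<phi> + \<phi> b * l\<close>.  In coordinates in which
  \<open>l\<close> is a variable \<open>y\<close>, the group becomes a finite set \<open>\<Gamma>\<close> of vectors \<open>\<beta>\<close>, acting by
  \<open>x\<^sub>i \<mapsto> x\<^sub>i + \<beta>\<^sub>i y\<close>, where \<open>\<beta>\<close> has determinant \<open>1 + \<beta>\<^sub>y\<close> and is a transvection if \<open>\<beta>\<^sub>y = 0\<close>.

  Generators are found by induction on the order of \<open>\<Gamma>\<close>, for the more general actions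
  \<open>x\<^sub>i \<mapsto> x\<^sub>i + \<beta>\<^sub>i y ^ d\<^sub>i\<close> with weights \<open>d\<close> (\<open>affine_group_invariants\<close>).  If \<open>\<Gamma>\<close> contains a transvection,
  consider all its multiples in \<open>\<Gamma>\<close>.  A shear that subtracts multiples of a coordinate \<open>x\<close> of least weight
  from the others makes these multiples move \<open>x\<close> only, by \<open>x \<mapsto> x + a y ^ d\<close> for \<open>a\<close> in a finite additive
  group \<open>A\<close>.  Their invariants are the polynomials in the other coordinates and the orbit product
  \<open>N = \<Prod>a\<in>A. x + a y ^ d\<close> (\<open>invariants_of_translations\<close>).  The point is that \<open>N\<close> is an additive polynomial
  in \<open>x\<close> (\<open>N_additive\<close>): every element of \<open>\<Gamma>\<close> moves \<open>N\<close>, too, by a constant times a power of \<open>y\<close>.  So the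
  action on the new coordinates has the same shape, but it factors through a smaller group.  A group
  without transvections lies on a single line; after a shear it only scales \<open>y\<close>, and \<open>y ^ e\<close> with \<open>e\<close> the
  order of the group replaces \<open>y\<close>.  Choosing all multiples of a transvection, rather than a cyclic
  group, keeps the construction stable under the scalars \<open>1 + \<beta>\<^sub>y\<close>.

  By the chain rule the Jacobian determinant of the generators is the product of the contributions
  of the steps.  Shears contribute \<open>1\<close>, an orbit product contributes its derivative in \<open>x\<close>, which for
  an additive polynomial is a constant times a power of \<open>y\<close> (\<open>partial_deriv_N\<close>), and \<open>y ^ e\<close> contributes
  \<open>e y ^ (e - 1)\<close>, where \<open>e \<noteq> 0\<close> in the field (\<open>of_nat_card_nonzero\<close>).  So it is a power of \<open>y = l\<close> up to a
  nonzero constant.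

  Finally, the Jacobians of two systems of generators of the same algebra differ by a unit
  (\<open>jacobian_generators_unit\<close>).  The Jacobian of homogeneous generators is homogeneous of degree the
  sum of the exponents, which forces the unit to be constant and fixes the power of \<open>l\<close>.
\<close>

section \<open>Substitution and differentiation of polynomials\<close>

lemma mpoly_single_induct [case_names zero single add]:
  fixes p :: "('n, 'a::field) mpoly"
  assumes "P 0" and "\<And>e c. P (Poly_Mapping.single e c)"
    and "\<And>p q. P p \<Longrightarrow> P q \<Longrightarrow> P (p + q)"
  shows "P p"
proof (induction p rule: update_induct)
  case const
  show ?case by (fact assms(1))
next
  case (update f a b)
  have "Poly_Mapping.update a b f = f + Poly_Mapping.single a b"
    using update(1)
    by (auto intro!: poly_mapping_eqI simp: lookup_update lookup_add lookup_single in_keys_iff when_def)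
  then show ?case using update assms by simp
qed

lemma Const_0 [simp]: "Const 0 = 0"
  and Const_1 [simp]: "Const 1 = 1"
  and Const_add: "Const (a + b) = Const a + Const b"
  and Const_diff: "Const (a - b) = Const a - Const b"
  and Const_uminus: "Const (- a) = - Const a"
  and Const_mult: "Const (a * b) = Const a * Const b"
  by (simp_all add: Const_def single_add single_diff single_uminus mult_single)

lemma Const_power: "Const (a ^ k) = Const a ^ k"
  by (induction k) (simp_all add: Const_mult)

lemma Const_sum: "Const (sum f A) = (\<Sum>x\<in>A. Const (f x))"
  by (induction A rule: infinite_finite_induct) (simp_all add: Const_add)

lemma Const_prod: "Const (prod f A) = (\<Prod>x\<in>A. Const (f x))"
  by (induction A rule: infinite_finite_induct) (simp_all add: Const_mult)

lemma Const_of_nat: "Const (of_nat k) = of_nat k"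
  by (simp add: Const_def)

lemma Const_eq_iff [simp]: "Const a = Const b \<longleftrightarrow> a = b"
  by (metis Const_def lookup_single_eq)

lemma lookup_Const_mult: "Poly_Mapping.lookup (Const c * p) e = c * Poly_Mapping.lookup p e"
proof (induction p rule: mpoly_single_induct)
  case (single e' d)
  show ?case by (simp add: Const_def mult_single lookup_single when_def)
qed (simp_all add: algebra_simps lookup_add)

lemma Var_power: "Var j ^ k = Poly_Mapping.single (Poly_Mapping.single j k) 1"
  by (induction k) (simp_all add: Var_def mult_single single_add[symmetric])

lemma single_eq_monomial:
  "Poly_Mapping.single e c = Const c * (\<Prod>i\<in>UNIV. Var (i::'n::finite) ^ Poly_Mapping.lookup e i)"
proof -
  have prod: "(\<Prod>i\<in>A. Poly_Mapping.single (h i) (1::'a)) = Poly_Mapping.single (\<Sum>i\<in>A. h i) 1"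
    if "finite A" for A :: "'n set" and h :: "'n \<Rightarrow> ('n \<Rightarrow>\<^sub>0 nat)"
    using that by (induction A) (simp_all add: mult_single)
  have "(\<Sum>i\<in>UNIV. Poly_Mapping.single i (Poly_Mapping.lookup e i)) = e"
    by (rule poly_mapping_eqI) (simp add: lookup_sum lookup_single when_def)
  then show ?thesis
    by (simp add: Var_power prod Const_def mult_single)
qed

lemma subst_poly_zero [simp]: "subst_poly \<sigma> 0 = 0"
  by (simp add: subst_poly_def)

lemma subst_poly_single:
  "subst_poly \<sigma> (Poly_Mapping.single e c) = Const c * (\<Prod>i\<in>UNIV. \<sigma> i ^ Poly_Mapping.lookup e i)"
  by (auto simp: subst_poly_def)

lemma subst_poly_superset:
  assumes "finite S" "Poly_Mapping.keys p \<subseteq> S"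
  shows "subst_poly \<sigma> p =
     (\<Sum>e\<in>S. Const (Poly_Mapping.lookup p e) * (\<Prod>i\<in>UNIV. \<sigma> i ^ Poly_Mapping.lookup e i))"
  unfolding subst_poly_def
  by (rule sum.mono_neutral_left) (use assms in \<open>auto simp: in_keys_iff\<close>)

lemma subst_poly_add [simp]: "subst_poly \<sigma> (p + q) = subst_poly \<sigma> p + subst_poly \<sigma> q"
proof -
  let ?S = "Poly_Mapping.keys p \<union> Poly_Mapping.keys q"
  have "Poly_Mapping.keys (p + q) \<subseteq> ?S" by (rule Poly_Mapping.keys_add)
  then show ?thesis
    by (simp add: subst_poly_superset[of ?S] lookup_add Const_add algebra_simps sum.distrib)
qed

lemma subst_poly_mult [simp]: "subst_poly \<sigma> (p * q) = subst_poly \<sigma> p * subst_poly \<sigma> q"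
proof (induction p rule: mpoly_single_induct)
  case (single e c)
  show ?case
  proof (induction q rule: mpoly_single_induct)
    case (single e' c')
    show ?case
      by (simp add: mult_single subst_poly_single Const_mult lookup_add power_add prod.distrib)
  qed (simp_all add: algebra_simps)
qed (simp_all add: algebra_simps)

lemma subst_poly_Const [simp]: "subst_poly \<sigma> (Const c) = Const c"
  using subst_poly_single[of \<sigma> 0 c] by (simp add: Const_def)

lemma subst_poly_one [simp]: "subst_poly \<sigma> 1 = 1"
  by (metis Const_1 subst_poly_Const)

lemma subst_poly_Var [simp]: "subst_poly \<sigma> (Var j) = \<sigma> j"
  by (simp add: Var_def subst_poly_single lookup_single when_def if_distrib[of "\<lambda>k. _ ^ k"]
      cong: if_cong)

lemma subst_poly_of_int [simp]: "subst_poly \<sigma> (of_int k) = of_int k"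
  by (metis Const_def single_of_int subst_poly_Const)

lemma subst_poly_uminus [simp]: "subst_poly \<sigma> (- p) = - subst_poly \<sigma> p"
  using subst_poly_add[of \<sigma> p "- p"] by (simp add: eq_neg_iff_add_eq_0 add.commute del: subst_poly_add)

lemma subst_poly_diff [simp]: "subst_poly \<sigma> (p - q) = subst_poly \<sigma> p - subst_poly \<sigma> q"
  using subst_poly_add[of \<sigma> p "- q"] by (simp del: subst_poly_add)

lemma subst_poly_power [simp]: "subst_poly \<sigma> (p ^ k) = subst_poly \<sigma> p ^ k"
  by (induction k) simp_all

lemma subst_poly_sum [simp]: "subst_poly \<sigma> (sum f A) = (\<Sum>x\<in>A. subst_poly \<sigma> (f x))"
  by (induction A rule: infinite_finite_induct) simp_all

lemma subst_poly_prod [simp]: "subst_poly \<sigma> (prod f A) = (\<Prod>x\<in>A. subst_poly \<sigma> (f x))"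
  by (induction A rule: infinite_finite_induct) simp_all

text \<open>
  Two \<open>'a\<close>-algebra homomorphisms agree once they agree on the variables; this rule is how such
  identities are checked below.
\<close>

lemma mpoly_induct [case_names Const Var add mult]:
  fixes p :: "('n::finite, 'a::field) mpoly"
  assumes const: "\<And>c. P (Const c)" and var: "\<And>j. P (Var j)"
    and add: "\<And>p q. P p \<Longrightarrow> P q \<Longrightarrow> P (p + q)" and mult: "\<And>p q. P p \<Longrightarrow> P q \<Longrightarrow> P (p * q)"
  shows "P p"
proof (induction p rule: mpoly_single_induct)
  case zero
  show ?case using const[of 0] by simp
next
  case (single e c)
  have one: "P 1" using const[of 1] by simp
  have pow: "P (Var j ^ k)" for j k
    by (induction k) (simp_all add: one mult var)
  have "P (\<Prod>i\<in>A. Var i ^ Poly_Mapping.lookup e i)" if "finite A" for A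
    using that by (induction A) (simp_all add: one pow mult)
  then show ?case by (simp add: single_eq_monomial const mult)
qed (rule add)

lemma subst_poly_subst_poly:
  "subst_poly \<sigma> (subst_poly \<tau> p) = subst_poly (\<lambda>i. subst_poly \<sigma> (\<tau> i)) p"
  by (induction p rule: mpoly_induct) simp_all

lemma subst_poly_Var_id [simp]: "subst_poly Var p = p"
  by (induction p rule: mpoly_induct) simp_all

text \<open>
  The transfer principle for changes of coordinates: to see how a substitution acts on polynomials
  in the \<open>f i\<close>, it suffices to see how it acts on the \<open>f i\<close> themselves.
\<close>

lemma subst_poly_intertwine:
  assumes "\<And>i. subst_poly \<sigma> (f i) = subst_poly f (\<rho> i)"
  shows "subst_poly \<sigma> (subst_poly f q) = subst_poly f (subst_poly \<rho> q)"
  by (simp add: subst_poly_subst_poly assms)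

lemma alg_independent_iff_inj: "alg_independent f \<longleftrightarrow> inj (subst_poly f)"
proof
  assume "alg_independent f"
  then show "inj (subst_poly f)"
    unfolding alg_independent_def inj_def by (metis right_minus_eq subst_poly_diff)
next
  assume "inj (subst_poly f)"
  then show "alg_independent f"
    unfolding alg_independent_def inj_def by (metis subst_poly_zero)
qed

lemma lookup_partial_deriv:
  "Poly_Mapping.lookup (partial_deriv j p) e =
     of_nat (Suc (Poly_Mapping.lookup e j)) * Poly_Mapping.lookup p (e + Poly_Mapping.single j 1)"
proof -
  let ?u = "Poly_Mapping.single j (1::nat)"
  have shift: "(e' - ?u = e) = (e' = e + ?u)" if "Poly_Mapping.lookup e' j \<noteq> 0" for e'
  proof
    assume "e' - ?u = e"
    moreover have "e' - ?u + ?u = e'"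
      by (rule poly_mapping_eqI)
        (use that in \<open>auto simp: lookup_add lookup_minus lookup_single when_def\<close>)
    ultimately show "e' = e + ?u" by simp
  next
    assume "e' = e + ?u"
    then show "e' - ?u = e"
      by simp
  qed
  have "Poly_Mapping.lookup (partial_deriv j p) e =
    (\<Sum>e'\<in>Poly_Mapping.keys p. (if e' = e + ?u
       then of_nat (Poly_Mapping.lookup e' j) * Poly_Mapping.lookup p e' else 0))"
    unfolding partial_deriv_def lookup_sum
  proof (rule sum.cong)
    fix e' assume "e' \<in> Poly_Mapping.keys p"
    show "Poly_Mapping.lookup (Poly_Mapping.single (e' - ?u)
        (of_nat (Poly_Mapping.lookup e' j) * Poly_Mapping.lookup p e')) e =
      (if e' = e + ?u then of_nat (Poly_Mapping.lookup e' j) * Poly_Mapping.lookup p e' else 0)"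
      using shift[of e'] by (cases "Poly_Mapping.lookup e' j = 0") (auto simp: lookup_single when_def)
  qed simp
  also have "\<dots> = of_nat (Suc (Poly_Mapping.lookup e j)) * Poly_Mapping.lookup p (e + ?u)"
    by (auto simp: in_keys_iff lookup_add lookup_single)
  finally show ?thesis .
qed

lemma partial_deriv_add [simp]: "partial_deriv j (p + q) = partial_deriv j p + partial_deriv j q"
  by (rule poly_mapping_eqI) (simp add: lookup_partial_deriv lookup_add algebra_simps)

lemma partial_deriv_zero [simp]: "partial_deriv j 0 = 0"
  by (simp add: partial_deriv_def)

lemma partial_deriv_single:
  "partial_deriv j (Poly_Mapping.single e c) =
     Poly_Mapping.single (e - Poly_Mapping.single j 1) (of_nat (Poly_Mapping.lookup e j) * c)"
  by (simp add: partial_deriv_def)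

lemma partial_deriv_mult [simp]:
  "partial_deriv j (p * q) = p * partial_deriv j q + q * partial_deriv j p"
proof (induction p rule: mpoly_single_induct)
  case (single e c)
  show ?case
  proof (induction q rule: mpoly_single_induct)
    case (single e' c')
    let ?u = "Poly_Mapping.single j (1::nat)"
    have move: "f + (e - ?u) = f + e - ?u" if "Poly_Mapping.lookup e j \<noteq> 0" for e f
      by (rule poly_mapping_eqI)
        (use that in \<open>auto simp: lookup_add lookup_minus lookup_single when_def\<close>)
    have 1: "Poly_Mapping.single e c * partial_deriv j (Poly_Mapping.single e' c') =
      Poly_Mapping.single (e + e' - ?u) (of_nat (Poly_Mapping.lookup e' j) * (c * c'))"
      using move[of e' e]
      by (cases "Poly_Mapping.lookup e' j = 0")
        (simp_all add: partial_deriv_single mult_single mult_ac)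
    have 2: "Poly_Mapping.single e' c' * partial_deriv j (Poly_Mapping.single e c) =
      Poly_Mapping.single (e + e' - ?u) (of_nat (Poly_Mapping.lookup e j) * (c * c'))"
      using move[of e e']
      by (cases "Poly_Mapping.lookup e j = 0")
        (simp_all add: partial_deriv_single mult_single ac_simps)
    show ?case
      unfolding 1 2
      unfolding mult_single partial_deriv_single
      by (simp add: lookup_add algebra_simps flip: single_add)
  qed (simp_all add: algebra_simps)
qed (simp_all add: algebra_simps)

lemma partial_deriv_Const [simp]: "partial_deriv j (Const c) = 0"
  by (simp add: Const_def partial_deriv_single)

lemma partial_deriv_one [simp]: "partial_deriv j 1 = 0"
  by (metis Const_1 partial_deriv_Const)

lemma partial_deriv_Var: "partial_deriv j (Var i) = (if i = j then 1 else 0)"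
  by (simp add: Var_def partial_deriv_single lookup_single)

lemma partial_deriv_uminus [simp]: "partial_deriv j (- p) = - partial_deriv j p"
  using partial_deriv_add[of j p "- p"]
  by (simp add: eq_neg_iff_add_eq_0 add.commute del: partial_deriv_add)

lemma partial_deriv_diff [simp]: "partial_deriv j (p - q) = partial_deriv j p - partial_deriv j q"
  using partial_deriv_add[of j p "- q"] by (simp del: partial_deriv_add)

lemma partial_deriv_sum [simp]: "partial_deriv j (sum f A) = (\<Sum>x\<in>A. partial_deriv j (f x))"
  by (induction A rule: infinite_finite_induct) simp_all

lemma partial_deriv_power_Var:
  "partial_deriv j (Var i ^ k) = (if i = j then of_nat k * Var j ^ (k - 1) else 0)"
proof (induction k)
  case (Suc k)
  then show ?case
    by (cases k) (auto simp: partial_deriv_Var algebra_simps)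
qed simp

lemma partial_deriv_subst_poly:
  "partial_deriv j (subst_poly \<sigma> p) =
     (\<Sum>i\<in>UNIV. subst_poly \<sigma> (partial_deriv i p) * partial_deriv j (\<sigma> i))"
proof (induction p rule: mpoly_induct)
  case (Var k)
  have "(\<Sum>i\<in>UNIV. subst_poly \<sigma> (partial_deriv i (Var k)) * partial_deriv j (\<sigma> i)) =
    (\<Sum>i\<in>UNIV. if k = i then partial_deriv j (\<sigma> i) else 0)"
    by (rule sum.cong) (auto simp: partial_deriv_Var)
  then show ?case by simp
qed (simp_all add: algebra_simps sum.distrib sum_distrib_left)

section \<open>Jacobian determinants\<close>

lemma det_subst_poly: "subst_poly \<sigma> (det A) = det (\<chi> i j. subst_poly \<sigma> (A $ i $ j))"
  by (simp add: det_def)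

text \<open>
  The chain rule is a product of matrices, so Jacobian determinants multiply along successive
  changes of generators.
\<close>

lemma jacobian_subst_poly:
  "jacobian (\<lambda>i. subst_poly f (P i)) = subst_poly f (jacobian P) * jacobian f"
proof -
  have "(\<chi> i j. partial_deriv j (subst_poly f (P i))) =
    (\<chi> i j. subst_poly f (partial_deriv j (P i))) ** (\<chi> i j. partial_deriv j (f i))"
    by (simp add: matrix_matrix_mult_def partial_deriv_subst_poly)
  then show ?thesis
    by (simp add: jacobian_def det_subst_poly det_mul)
qed

text \<open>
  Triangularity for an index type without an order: a ranking of the indices takes its place, and
  indices of equal rank may only meet on the diagonal.  A permutation contributing to the
  determinant never raises the rank, hence preserves it, hence is the identity.
\<close>

lemma det_triangular_rank:
  fixes A :: "'a::comm_ring_1^'n^'n" and r :: "'n \<Rightarrow> nat"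
  assumes tri: "\<And>i k. i \<noteq> k \<Longrightarrow> r i \<le> r k \<Longrightarrow> A $ i $ k = 0"
  shows "det A = (\<Prod>i\<in>UNIV. A $ i $ i)"
proof -
  let ?PU = "{p. p permutes (UNIV :: 'n set)}"
  let ?pp = "\<lambda>p. of_int (sign p) * prod (\<lambda>i. A$i$p i) (UNIV :: 'n set)"
  have p0: "?pp p = 0" if p: "p permutes UNIV" "p \<noteq> id" for p
  proof (rule ccontr)
    assume nz: "?pp p \<noteq> 0"
    have nz': "A $ i $ p i \<noteq> 0" for i
      using nz prod_zero[OF finite, where f = "\<lambda>i. A $ i $ p i"] by (metis UNIV_I mult_zero_right)
    have le: "r (p i) \<le> r i" for i
      using tri[of i "p i"] nz'[of i] by (metis nat_le_linear)
    obtain i where "p i \<noteq> i" using p(2) by (metis eq_id_iff)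
    then have "r (p i) < r i" using tri[of i "p i"] nz'[of i] by (metis not_le)
    then have "(\<Sum>i\<in>UNIV. r (p i)) < (\<Sum>i\<in>UNIV. r i)"
      by (intro sum_strict_mono_ex1) (use le in auto)
    moreover have "(\<Sum>i\<in>UNIV. r (p i)) = (\<Sum>i\<in>UNIV. r i)"
      using sum.permute[OF p(1), of r] by (simp add: comp_def)
    ultimately show False by simp
  qed
  have "det A = (\<Sum>p\<in>{id}. ?pp p)"
    unfolding det_def
    by (rule sum.mono_neutral_right) (auto simp: finite_permutations permutes_id p0 simp del: mult_eq_0_iff)
  then show ?thesis by (simp add: sign_id)
qed

section \<open>Degree in one variable\<close>

definition deg_less :: "'n \<Rightarrow> nat \<Rightarrow> ('n, 'a::field) mpoly \<Rightarrow> bool" where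
  "deg_less x m p \<longleftrightarrow> (\<forall>e\<in>Poly_Mapping.keys p. Poly_Mapping.lookup e x < m)"

lemma deg_less_0_iff [simp]: "deg_less x 0 p \<longleftrightarrow> p = 0"
  by (simp add: deg_less_def)

lemma deg_less_zero [simp]: "deg_less x m 0"
  by (simp add: deg_less_def)

lemma deg_less_mono: "deg_less x m p \<Longrightarrow> m \<le> k \<Longrightarrow> deg_less x k p"
  by (force simp: deg_less_def)

lemma deg_less_exists: "\<exists>m. deg_less x m p"
proof -
  have "Poly_Mapping.lookup e x < Suc (\<Sum>e\<in>Poly_Mapping.keys p. Poly_Mapping.lookup e x)"
    if "e \<in> Poly_Mapping.keys p" for e
    using member_le_sum[OF that, of "\<lambda>e. Poly_Mapping.lookup e x"] by (simp add: less_Suc_eq_le)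
  then show ?thesis unfolding deg_less_def by blast
qed

lemma deg_less_add: "deg_less x m p \<Longrightarrow> deg_less x m q \<Longrightarrow> deg_less x m (p + q)"
  unfolding deg_less_def using Poly_Mapping.keys_add[of p q] by blast

lemma deg_less_uminus: "deg_less x m p \<Longrightarrow> deg_less x m (- p)"
  by (simp add: deg_less_def in_keys_iff)

lemma deg_less_diff: "deg_less x m p \<Longrightarrow> deg_less x m q \<Longrightarrow> deg_less x m (p - q)"
  using deg_less_add[of x m p "- q"] deg_less_uminus[of x m q] by simp

lemma deg_less_mult:
  assumes "deg_less x (Suc m) p" "deg_less x k q"
  shows "deg_less x (m + k) (p * q)"
  unfolding deg_less_def
proof
  fix e assume "e \<in> Poly_Mapping.keys (p * q)"
  then obtain a b where "e = a + b" "a \<in> Poly_Mapping.keys p" "b \<in> Poly_Mapping.keys q"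
    using keys_mult[of p q] by blast
  with assms show "Poly_Mapping.lookup e x < m + k"
    by (fastforce simp: deg_less_def lookup_add)
qed

lemma deg_less_Const [simp]: "deg_less x (Suc m) (Const c)"
  by (simp add: deg_less_def Const_def)

lemma deg_less_one [simp]: "deg_less x (Suc m) 1"
  by (simp add: deg_less_def)

lemma deg_less_Var: "i \<noteq> x \<or> 0 < m \<Longrightarrow> deg_less x (Suc m) (Var i)"
  by (auto simp: deg_less_def Var_def lookup_single when_def)

lemma deg_less_free_mult: "deg_less x 1 p \<Longrightarrow> deg_less x k q \<Longrightarrow> deg_less x k (p * q)"
  using deg_less_mult[of x 0 p k q] by simp

lemma deg_less_free_power: "deg_less x 1 p \<Longrightarrow> deg_less x 1 (p ^ k)"
  by (induction k) (simp_all add: deg_less_free_mult)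

lemma deg_less_partial_deriv: "deg_less x m p \<Longrightarrow> deg_less x (m - 1) (partial_deriv x p)"
  unfolding deg_less_def
proof
  fix e assume p: "\<forall>e\<in>Poly_Mapping.keys p. Poly_Mapping.lookup e x < m"
    and e: "e \<in> Poly_Mapping.keys (partial_deriv x p)"
  then have "e + Poly_Mapping.single x 1 \<in> Poly_Mapping.keys p"
    by (auto simp: in_keys_iff lookup_partial_deriv)
  with p show "Poly_Mapping.lookup e x < m - 1" by (fastforce simp: lookup_add)
qed

lemma subst_poly_free:
  assumes "deg_less x 1 p" "\<And>i. i \<noteq> x \<Longrightarrow> \<sigma> i = \<tau> i"
  shows "subst_poly \<sigma> p = subst_poly \<tau> p"
  unfolding subst_poly_def
proof (intro sum.cong refl arg_cong2[where f = "(*)"] prod.cong)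
  fix e i assume "e \<in> Poly_Mapping.keys p"
  then have "Poly_Mapping.lookup e x = 0" using assms(1) by (auto simp: deg_less_def)
  then show "\<sigma> i ^ Poly_Mapping.lookup e i = \<tau> i ^ Poly_Mapping.lookup e i"
    using assms(2)[of i] by (cases "i = x") auto
qed

lemma subst_poly_upd_free: "deg_less x 1 p \<Longrightarrow> subst_poly (Var(x := t)) p = p"
  using subst_poly_free[of x p "Var(x := t)" Var] by simp

lemma deg_less_subst_poly_free: 
  assumes "deg_less x 1 t"
  shows "deg_less x 1 (subst_poly (Var(x := t)) p)"
proof (induction p rule: mpoly_induct)
  case (Var j)
  show ?case using assms deg_less_Var[of j x 0] by (cases "j = x") simp_all
next
  case (mult p q)
  then show ?case by (simp add: deg_less_free_mult del: One_nat_def)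
qed (simp_all add: deg_less_add)

text \<open>
  The leading term in \<open>Var x\<close> of \<open>(Var x + s) * r\<close> is \<open>Var x\<close> times the leading term of \<open>r\<close>.
  The case \<open>m = 0\<close> says that monic linear factors are not zero divisors.
\<close>

lemma deg_less_cancel_linear:
  fixes r s :: "('n, 'a::field) mpoly"
  assumes s: "deg_less x 1 s" and m: "deg_less x m ((Var x + s) * r)"
  shows "deg_less x (m - 1) r"
proof (cases "r = 0")
  case False
  define k where "k = Max ((\<lambda>e. Poly_Mapping.lookup e x) ` Poly_Mapping.keys r)"
  have ne: "Poly_Mapping.keys r \<noteq> {}" using False by simp
  then have "k \<in> (\<lambda>e. Poly_Mapping.lookup e x) ` Poly_Mapping.keys r"
    unfolding k_def by (intro Max_in) auto
  then obtain e where e: "e \<in> Poly_Mapping.keys r" "Poly_Mapping.lookup e x = k" by auto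
  have le: "Poly_Mapping.lookup e' x \<le> k" if "e' \<in> Poly_Mapping.keys r" for e'
    unfolding k_def by (intro Max_ge) (use that in auto)
  \<comment> \<open>The monomial \<open>e\<close> has the largest exponent \<open>k\<close> of \<open>x\<close>; its product with \<open>x\<close> cannot be cancelled by \<open>s * r\<close>.\<close>
  let ?e = "Poly_Mapping.single x 1 + e"
  have shift: "Poly_Mapping.lookup (Var x * p) (Poly_Mapping.single x 1 + e) = Poly_Mapping.lookup p e"
    for p :: "('n, 'a) mpoly" and e
    by (induction p rule: mpoly_single_induct)
      (simp_all add: Var_def mult_single lookup_single when_def algebra_simps lookup_add)
  have "deg_less x (Suc k) r" using le by (simp add: deg_less_def less_Suc_eq_le)
  then have "deg_less x (Suc k) (s * r)" by (rule deg_less_free_mult[OF s])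
  moreover have "Poly_Mapping.lookup ?e x = Suc k" using e(2) by (simp add: lookup_add)
  ultimately have "Poly_Mapping.lookup (s * r) ?e = 0"
    by (metis deg_less_def in_keys_iff less_irrefl)
  then have "Poly_Mapping.lookup ((Var x + s) * r) ?e = Poly_Mapping.lookup r e"
    by (simp add: distrib_right lookup_add shift[unfolded One_nat_def])
  then have "?e \<in> Poly_Mapping.keys ((Var x + s) * r)" using e(1) by (simp add: in_keys_iff)
  then have "Suc k < m" using m e(2) by (auto simp: deg_less_def lookup_add)
  then show ?thesis using le by (force simp: deg_less_def)
qed simp

lemma linear_mult_eq_0:
  assumes "deg_less x 1 s" "(Var x + s) * r = 0"
  shows "r = 0"
  using deg_less_cancel_linear[of x s 0 r] assms by simp

lemma Var_mult_eq_0: "Var x * r = 0 \<Longrightarrow> r = 0"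
  using linear_mult_eq_0[of x 0 r] by simp

lemma Var_power_mult_eq_0: "Var x ^ k * r = 0 \<Longrightarrow> r = 0"
  by (induction k) (auto simp: mult.assoc dest: Var_mult_eq_0)

lemma Var_power_mult_cancel: "Var x ^ k * r = Var x ^ k * s \<Longrightarrow> r = s"
  using Var_power_mult_eq_0[of x k "r - s"] by (simp add: algebra_simps)

text \<open>
  The factor theorem: replacing \<open>Var x\<close> by \<open>t\<close> is reduction modulo \<open>Var x - t\<close>.
\<close>

lemma linear_factor:
  fixes p :: "('n::finite, 'a::field) mpoly"
  obtains r where "p = subst_poly (Var(x := t)) p + (Var x - t) * r"
proof -
  define \<sigma> where "\<sigma> = Var(x := t)"
  have "\<exists>r. p = subst_poly \<sigma> p + (Var x - t) * r"
  proof (induction p rule: mpoly_induct)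
    case (Const c)
    show ?case by (intro exI[of _ 0]) simp
  next
    case (Var j)
    have "Var j = \<sigma> j + (Var x - t) * (if j = x then 1 else 0)" by (simp add: \<sigma>_def)
    then show ?case by (metis subst_poly_Var)
  next
    case (add p q)
    then obtain r s where "p = subst_poly \<sigma> p + (Var x - t) * r"
      "q = subst_poly \<sigma> q + (Var x - t) * s" by blast
    then have "p + q = subst_poly \<sigma> (p + q) + (Var x - t) * (r + s)"
      unfolding subst_poly_add distrib_left by (metis (no_types, lifting) add.assoc add.left_commute)
    then show ?case by blast
  next
    case (mult p q)
    then obtain r s where rs: "p = subst_poly \<sigma> p + (Var x - t) * r"
      "q = subst_poly \<sigma> q + (Var x - t) * s" by blast
    define p' q' where "p' = subst_poly \<sigma> p" and "q' = subst_poly \<sigma> q"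
    have "p * q = (p' + (Var x - t) * r) * (q' + (Var x - t) * s)"
      using rs by (simp add: p'_def q'_def)
    also have "\<dots> = subst_poly \<sigma> (p * q) + (Var x - t) * (r * q' + p' * s + (Var x - t) * r * s)"
      by (simp add: algebra_simps p'_def q'_def)
    finally show ?case by blast
  qed
  then show ?thesis using that by (auto simp: \<sigma>_def)
qed

lemma subst_poly_upd_upd:
  "subst_poly (Var(x := s)) (subst_poly (Var(x := t)) q) =
     subst_poly (Var(x := subst_poly (Var(x := s)) t)) q"
proof -
  have "(\<lambda>i. subst_poly (Var(x := s)) ((Var(x := t)) i)) = Var(x := subst_poly (Var(x := s)) t)"
    by auto
  then show ?thesis by (simp only: subst_poly_subst_poly)
qed

text \<open>
  Vanishing of \<open>M\<close> at \<open>x = 0\<close> lets one peel off factors: if \<open>q\<close> becomes \<open>0\<close> after substituting \<open>M\<close>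
  for \<open>Var x\<close>, then \<open>q\<close> itself vanishes at \<open>x = 0\<close>, so \<open>q = Var x * r\<close>, and \<open>r\<close> is killed as well but
  has smaller degree.
\<close>

lemma subst_poly_upd_inj:
  fixes M :: "('n::finite, 'a::field) mpoly"
  assumes cancel: "\<And>r. M * r = 0 \<Longrightarrow> r = 0" and M0: "subst_poly (Var(x := 0)) M = 0"
  shows "inj (subst_poly (Var(x := M)))"
proof -
  let ?N = "subst_poly (Var(x := M))" and ?Z = "subst_poly (Var(x := 0 :: ('n, 'a) mpoly))"
  have deg: "q = 0" if "deg_less x m q" "?N q = 0" for m q
    using that
  proof (induction m arbitrary: q)
    case (Suc m)
    have "?Z q = ?Z (?N q)"
      by (simp add: subst_poly_upd_upd M0)
    then have "?Z q = 0" using Suc.prems by simp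
    with linear_factor[of q x 0] obtain r where r: "q = Var x * r" by (metis add_0 diff_zero)
    have "?N q = 0" by (rule Suc.prems)
    then have "M * ?N r = 0" by (simp add: r)
    then have "?N r = 0" by (rule cancel)
    moreover have "deg_less x m r"
      using deg_less_cancel_linear[of x 0 "Suc m" r] Suc.prems r by simp
    ultimately have "r = 0" using Suc.IH by blast
    then show ?case using r by simp
  qed simp
  have "alg_independent (Var(x := M))"
    unfolding alg_independent_def
  proof (intro allI impI)
    fix q assume "?N q = 0"
    moreover obtain m where "deg_less x m q" using deg_less_exists[of x q] by blast
    ultimately show "q = 0" by (rule deg[rotated])
  qed
  then show ?thesis by (simp add: alg_independent_iff_inj)
qed

section \<open>Orbit polynomials of a line of transvections\<close>

definition orbit_poly :: "'n \<Rightarrow> ('n, 'a::field) mpoly \<Rightarrow> 'a set \<Rightarrow> ('n, 'a) mpoly" where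
  "orbit_poly x Y A = (\<Prod>a\<in>A. Var x + Const a * Y)"

lemma orbit_poly_insert:
  "finite A \<Longrightarrow> a \<notin> A \<Longrightarrow> orbit_poly x Y (insert a A) = (Var x + Const a * Y) * orbit_poly x Y A"
  by (simp add: orbit_poly_def)

text \<open>
  The additive group \<open>A\<close> acts by the transvections \<open>Var x \<mapsto> Var x + a * Var y ^ d\<close>, and \<open>N\<close> below is
  the product over the orbit of \<open>Var x\<close>.  The value of \<open>N\<close> at \<open>b * Var y ^ d\<close> is
  \<open>orbit_value b * Var y ^ (d * card A)\<close>.
\<close>

locale transvection_line =
  fixes x y :: "'n::finite" and d :: nat and A :: "'a::field set"
  assumes xy: "x \<noteq> y" and fin: "finite A" and zero: "0 \<in> A"
    and add_closed: "\<And>a b. a \<in> A \<Longrightarrow> b \<in> A \<Longrightarrow> a + b \<in> A"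
begin

definition Y :: "('n, 'a) mpoly" where "Y = Var y ^ d"

abbreviation N :: "('n, 'a) mpoly" where "N \<equiv> orbit_poly x Y A"

definition orbit_value :: "'a \<Rightarrow> 'a" where "orbit_value b = (\<Prod>a\<in>A. b + a)"

lemma Y_free: "deg_less x 1 (Const c * Y)"
  unfolding Y_def using deg_less_free_power[of x "Var y" d] xy deg_less_Var[of y x 0]
  by (intro deg_less_free_mult) simp_all

lemma subst_Y [simp]: "subst_poly (Var(x := t)) Y = Y"
  unfolding Y_def using xy by simp

lemma deg_less_cancel_orbit_poly:
  assumes "finite B" "deg_less x m (orbit_poly x Y B * r)"
  shows "deg_less x (m - card B) r"
  using assms
proof (induction B arbitrary: m)
  case (insert a B)
  then have "deg_less x m ((Var x + Const a * Y) * (orbit_poly x Y B * r))"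
    by (simp add: orbit_poly_insert mult.assoc)
  then have "deg_less x (m - 1) (orbit_poly x Y B * r)" by (rule deg_less_cancel_linear[OF Y_free])
  then show ?case using insert by fastforce
qed (simp add: orbit_poly_def)

lemma N_cancel: "N * r = 0 \<Longrightarrow> r = 0"
  using deg_less_cancel_orbit_poly[OF fin, of 0 r] by simp

text \<open>
  Distinct linear factors can be divided out one after the other, because the value of the earlier
  ones at the next root is a nonzero constant times a power of \<open>Var y\<close>, which can be cancelled.
\<close>

lemma orbit_poly_dvd:
  assumes "finite B" "\<And>a. a \<in> B \<Longrightarrow> subst_poly (Var(x := - Const a * Y)) p = 0"
  shows "\<exists>r. p = orbit_poly x Y B * r"
  using assms
proof (induction B)
  case (insert a B)
  then obtain r where r: "p = orbit_poly x Y B * r" by auto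
  let ?S = "subst_poly (Var(x := - Const a * Y))"
  have "?S p = 0" by (rule insert.prems) simp
  then have "?S (orbit_poly x Y B) * ?S r = 0" by (simp only: r subst_poly_mult)
  moreover have "?S (orbit_poly x Y B) = Const (\<Prod>b\<in>B. b - a) * Y ^ card B"
  proof -
    have "?S (orbit_poly x Y B) = (\<Prod>b\<in>B. Const (b - a) * Y)"
      by (simp add: orbit_poly_def Const_diff algebra_simps)
    then show ?thesis by (simp add: prod.distrib Const_prod)
  qed
  ultimately have *: "Y ^ card B * (Const (\<Prod>b\<in>B. b - a) * ?S r) = 0" by (simp add: mult_ac)
  have "Const (\<Prod>b\<in>B. b - a) * ?S r = 0"
    using * unfolding Y_def power_mult[symmetric] by (rule Var_power_mult_eq_0)
  moreover have "(\<Prod>b\<in>B. b - a) \<noteq> 0" using insert.hyps by auto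
  ultimately have "Const (inverse (\<Prod>b\<in>B. b - a)) * Const (\<Prod>b\<in>B. b - a) * ?S r = 0"
    by (simp add: mult.assoc)
  then have "?S r = 0" using \<open>(\<Prod>b\<in>B. b - a) \<noteq> 0\<close> by (simp flip: Const_mult)
  with linear_factor[of r x "- Const a * Y"] obtain s where "r = (Var x - - Const a * Y) * s"
    by (metis add_0)
  then have "r = (Var x + Const a * Y) * s" by simp
  then have "p = orbit_poly x Y (insert a B) * s"
    using r insert.hyps by (simp add: orbit_poly_insert mult_ac)
  then show ?case by blast
qed (simp add: orbit_poly_def)

lemma translate_A: "a \<in> A \<Longrightarrow> (\<lambda>b. a + b) ` A = A"
  using fin add_closed by (intro card_subset_eq) (auto simp: card_image)

text \<open>
  A finite set closed under addition and containing \<open>0\<close> is a group, translations of it being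
  injective and hence onto.
\<close>

lemma neg_closed: "a \<in> A \<Longrightarrow> - a \<in> A"
  using translate_A[of a] zero by (metis add_eq_0_iff imageE neg_eq_iff_add_eq_0)

lemma prod_translate:
  assumes "a \<in> A"
  shows "(\<Prod>b\<in>A. f (a + b)) = (\<Prod>b\<in>A. f b)"
proof -
  have "(\<Prod>b\<in>A. f b) = (\<Prod>b\<in>(\<lambda>b. a + b) ` A. f b)" using translate_A[OF assms] by simp
  also have "\<dots> = (\<Prod>b\<in>A. f (a + b))" by (subst prod.reindex) auto
  finally show ?thesis by simp
qed

lemma N_translate:
  assumes "a \<in> A"
  shows "subst_poly (Var(x := Var x + Const a * Y)) N = N"
proof -
  have "subst_poly (Var(x := Var x + Const a * Y)) N = (\<Prod>b\<in>A. Var x + Const (a + b) * Y)"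
    by (simp add: orbit_poly_def Const_add algebra_simps)
  then show ?thesis using prod_translate[OF assms, of "\<lambda>b. Var x + Const b * Y"]
    by (simp add: orbit_poly_def)
qed

lemma N_at_0: "subst_poly (Var(x := 0)) N = 0"
  using zero fin by (auto simp: orbit_poly_def intro!: prod_zero bexI[of _ 0])

lemma card_A_pos: "card A > 0" using zero fin card_gt_0_iff by blast

text \<open>
  An invariant \<open>q\<close> takes one and the same value on the whole orbit of the point \<open>x = 0\<close>, so
  subtracting this value gives a multiple of the orbit polynomial.
\<close>

lemma invariant_split:
  assumes inv: "\<And>a. a \<in> A \<Longrightarrow> subst_poly (Var(x := Var x + Const a * Y)) q = q"
  obtains r where "q = subst_poly (Var(x := 0)) q + N * r"
proof -
  let ?Z = "subst_poly (Var(x := 0))"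
  have "subst_poly (Var(x := - Const a * Y)) (q - ?Z q) = 0" if a: "a \<in> A" for a
  proof -
    let ?S = "subst_poly (Var(x := - Const a * Y))"
    have "?Z q = ?Z (subst_poly (Var(x := Var x + Const (- a) * Y)) q)"
      using inv[OF neg_closed[OF a]] by simp
    also have "\<dots> = ?S q"
      by (simp add: subst_poly_upd_upd Const_uminus)
    finally have "?Z q = ?S q" .
    moreover have "?S (?Z q) = ?Z q"
      by (intro subst_poly_upd_free deg_less_subst_poly_free) simp
    ultimately show ?thesis by simp
  qed
  then obtain r where "q - ?Z q = N * r" using orbit_poly_dvd[OF fin] by blast
  then show ?thesis using that[of r] by (simp add: algebra_simps)
qed

text \<open>
  Iterating \<open>invariant_split\<close>: the cofactor \<open>r\<close> is again invariant and has smaller degree in \<open>Var x\<close>.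
\<close>

lemma invariants_of_translations:
  assumes inv: "\<And>a. a \<in> A \<Longrightarrow> subst_poly (Var(x := Var x + Const a * Y)) q = q"
  shows "q \<in> range (subst_poly (Var(x := N)))"
proof -
  let ?Z = "subst_poly (Var(x := 0))"
  obtain m where "deg_less x m q" using deg_less_exists[of x q] by blast
  then show ?thesis using inv
  proof (induction m arbitrary: q rule: less_induct)
    case (less m)
    obtain r where r: "q = ?Z q + N * r" using invariant_split[OF less.prems(2)] by blast
    have Zfree: "deg_less x 1 (?Z q)" by (rule deg_less_subst_poly_free) simp
    then have Z: "?Z q = subst_poly (Var(x := N)) (?Z q)" by (simp add: subst_poly_upd_free)
    show ?case
    proof (cases "m = 0")
      case True
      then have "q = subst_poly (Var(x := N)) 0" using less.prems by simp
      then show ?thesis by blast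
    next
      case False
      have lt: "m - card A < m" using False card_A_pos by linarith
      have "deg_less x m (q - ?Z q)"
        using less.prems(1) Zfree False by (intro deg_less_diff) (auto elim: deg_less_mono)
      then have "deg_less x m (N * r)" using r by (metis add_diff_cancel_left')
      then have deg: "deg_less x (m - card A) r" by (rule deg_less_cancel_orbit_poly[OF fin])
      have "subst_poly (Var(x := Var x + Const a * Y)) r = r" if a: "a \<in> A" for a
      proof -
        let ?T = "subst_poly (Var(x := Var x + Const a * Y))"
        have "?T q = q" by (rule less.prems(2)[OF a])
        then have "q = ?T (?Z q + N * r)" using arg_cong[OF r, of ?T] by (rule trans[OF sym])
        also have "\<dots> = ?Z q + N * ?T r"
          using subst_poly_upd_free[OF Zfree] N_translate[OF a] by simp
        finally have "?Z q + N * ?T r = ?Z q + N * r" using r by (rule trans[OF sym])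
        then have "N * (?T r - r) = 0" by (simp add: right_diff_distrib)
        then show ?thesis using N_cancel by fastforce
      qed
      then have "r \<in> range (subst_poly (Var(x := N)))"
        by (rule less.IH[OF lt deg])
      then obtain s where s: "r = subst_poly (Var(x := N)) s" by blast
      have "subst_poly (Var(x := N)) (?Z q + Var x * s) = ?Z q + N * r"
        by (simp add: Z[symmetric] s)
      then have "q = subst_poly (Var(x := N)) (?Z q + Var x * s)"
        using r by (rule trans[OF _ sym, rotated])
      then show ?thesis by blast
    qed
  qed
qed

lemma N_inj: "inj (subst_poly (Var(x := N)))"
  by (rule subst_poly_upd_inj[OF N_cancel N_at_0])

lemma orbit_poly_monic:
  assumes "finite B"
  shows "deg_less x (card B) ((\<Prod>a\<in>B. Var x + Const (f a) * Y) - Var x ^ card B)"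
  using assms
proof (induction B)
  case (insert a B)
  let ?P = "\<Prod>a\<in>B. Var x + Const (f a) * Y"
  have "deg_less x (Suc (card B)) ((Var x + Const (f a) * Y) * (?P - Var x ^ card B))"
    using deg_less_mult[of x 1 "Var x + Const (f a) * Y" "card B"] insert.IH
    by (simp add: deg_less_add deg_less_Var deg_less_mono[OF Y_free])
  moreover have "deg_less x (Suc (card B)) (Const (f a) * Y * Var x ^ card B)"
  proof (rule deg_less_free_mult[OF Y_free])
    show "deg_less x (Suc (card B)) (Var x ^ card B)"
      by (simp add: deg_less_def Var_power)
  qed
  moreover have "(Var x + Const (f a) * Y) * ?P - Var x * Var x ^ card B =
    (Var x + Const (f a) * Y) * (?P - Var x ^ card B) + Const (f a) * Y * Var x ^ card B"
    by (simp add: algebra_simps)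
  ultimately show ?case using insert.hyps by (simp add: deg_less_add)
qed simp

text \<open>
  The orbit polynomial is additive in \<open>Var x\<close>: moving the argument by \<open>b * Var y ^ d\<close> adds a term
  free of \<open>Var x\<close>.  Both sides are monic of degree \<open>card A\<close> in \<open>Var x\<close> and agree on the \<open>card A\<close> points
  of the orbit of \<open>0\<close>.
\<close>

lemma N_additive: "(\<Prod>a\<in>A. Var x + Const (b + a) * Y) = N + Const (orbit_value b) * Y ^ card A"
proof -
  let ?D = "(\<Prod>a\<in>A. Var x + Const (b + a) * Y) - N - Const (orbit_value b) * Y ^ card A"
  have "subst_poly (Var(x := - Const a * Y)) ?D = 0" if a: "a \<in> A" for a
  proof -
    let ?S = "subst_poly (Var(x := - Const a * Y))"
    have "?S N = ?S (subst_poly (Var(x := Var x + Const a * Y)) N)" using N_translate[OF a] by simp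
    also have "\<dots> = subst_poly (Var(x := 0)) N"
      by (simp add: subst_poly_upd_upd)
    finally have "?S N = 0" using N_at_0 by simp
    moreover have shift: "- Const a * Y + Const (b + c) * Y = Const (b + (- a + c)) * Y" for c
      unfolding Const_add Const_uminus by (simp only: distrib_right mult_minus_left add_ac)
    have "?S (\<Prod>c\<in>A. Var x + Const (b + c) * Y) = (\<Prod>c\<in>A. Const (b + (- a + c)) * Y)"
      by (simp only: subst_poly_prod subst_poly_add subst_poly_mult subst_poly_Const subst_poly_Var
          subst_Y fun_upd_same shift)
    moreover have "\<dots> = (\<Prod>c\<in>A. Const (b + c) * Y)"
      by (rule prod_translate[OF neg_closed[OF a], of "\<lambda>c. Const (b + c) * Y"])
    ultimately show ?thesis by (simp add: prod.distrib Const_prod orbit_value_def)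
  qed
  then obtain r where r: "?D = N * r" using orbit_poly_dvd[OF fin] by blast
  have "deg_less x (card A) ?D"
  proof -
    have "deg_less x 1 (Const (orbit_value b) * Y ^ card A)"
      using deg_less_free_power[OF Y_free[of 1], of "card A"] by (intro deg_less_free_mult) simp_all
    then have "deg_less x (card A) (Const (orbit_value b) * Y ^ card A)"
      using card_A_pos by (elim deg_less_mono) simp
    moreover have "?D = ((\<Prod>a\<in>A. Var x + Const (b + a) * Y) - Var x ^ card A)
        - (N - Var x ^ card A) - Const (orbit_value b) * Y ^ card A" by simp
    ultimately show ?thesis
      using orbit_poly_monic[OF fin, of "\<lambda>a. b + a"] orbit_poly_monic[OF fin, of "\<lambda>a. a"]
      by (simp only: deg_less_diff orbit_poly_def)
  qed
  then have "r = 0" using deg_less_cancel_orbit_poly[OF fin, of "card A" r] r by simp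
  then show ?thesis using r by (simp add: algebra_simps)
qed

lemma orbit_value_additive: "orbit_value (b + c) = orbit_value b + orbit_value c"
proof -
  let ?S = "subst_poly (Var(x := Const c * Y))"
  have SN: "?S N = (\<Prod>a\<in>A. Const (c + a) * Y)"
    by (simp add: orbit_poly_def Const_add distrib_right)
  have "(\<Prod>a\<in>A. Const (b + c + a) * Y) = ?S (\<Prod>a\<in>A. Var x + Const (b + a) * Y)"
    by (simp add: Const_add distrib_right add_ac)
  also have "\<dots> = ?S (N + Const (orbit_value b) * Y ^ card A)"
    by (simp only: N_additive)
  also have "\<dots> = (\<Prod>a\<in>A. Const (c + a) * Y) + Const (orbit_value b) * Y ^ card A"
    by (simp add: SN)
  finally have "Const (orbit_value (b + c)) * Y ^ card A = Const (orbit_value c) * Y ^ card A + Const (orbit_value b) * Y ^ card A"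
    by (simp add: prod.distrib orbit_value_def Const_prod)
  then have "Y ^ card A * Const (orbit_value (b + c)) = Y ^ card A * Const (orbit_value b + orbit_value c)"
    by (simp add: Const_add algebra_simps)
  then have "Const (orbit_value (b + c)) = (Const (orbit_value b + orbit_value c) :: ('n, 'a) mpoly)"
    unfolding Y_def power_mult[symmetric] by (rule Var_power_mult_cancel)
  then show ?thesis by simp
qed

lemma orbit_value_at_A: "a \<in> A \<Longrightarrow> orbit_value a = 0"
  unfolding orbit_value_def using neg_closed[of a] fin by (auto intro!: prod_zero bexI[of _ "- a"])

text \<open>
  The derivative of the orbit polynomial is free of \<open>Var x\<close>: it is invariant under \<open>A\<close>, so its
  nonconstant part in \<open>Var x\<close> is a multiple of \<open>N\<close>, for which its degree is too small.  Its value is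
  then read off at \<open>x = 0\<close>, where only the factor with \<open>a = 0\<close> has to be differentiated.
\<close>

lemma partial_deriv_N:
  "partial_deriv x N = Const (\<Prod>(A - {0})) * Y ^ (card A - 1)"
proof -
  let ?D = "partial_deriv x N" and ?Z = "subst_poly (Var(x := 0))"
  have "subst_poly (Var(x := Var x + Const a * Y)) ?D = ?D" if a: "a \<in> A" for a
  proof -
    let ?T = "Var(x := Var x + Const a * Y)"
    have dT: "partial_deriv x (?T i) = (if i = x then 1 else 0)" for i
      using xy by (simp add: partial_deriv_Var Y_def partial_deriv_power_Var)
    have "?D = partial_deriv x (subst_poly ?T N)" using N_translate[OF a] by simp
    also have "\<dots> = subst_poly ?T ?D"
      unfolding partial_deriv_subst_poly dT by (simp add: if_distrib cong: if_cong)
    finally show ?thesis by simp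
  qed
  then obtain r where r: "?D = ?Z ?D + N * r" using invariant_split by blast
  have "deg_less x (card A + 1) N"
  proof -
    have "deg_less x (card A + 1) (Var x ^ card A)" by (simp add: deg_less_def Var_power)
    moreover have "deg_less x (card A + 1) (N - Var x ^ card A)"
      using orbit_poly_monic[OF fin, of "\<lambda>a. a"] by (auto simp: orbit_poly_def elim: deg_less_mono)
    ultimately show ?thesis using deg_less_add by fastforce
  qed
  then have "deg_less x (card A) ?D" using deg_less_partial_deriv by fastforce
  moreover have "deg_less x 1 (?Z ?D)" by (rule deg_less_subst_poly_free) simp
  ultimately have "deg_less x (card A) (?D - ?Z ?D)"
    using card_A_pos by (intro deg_less_diff) (auto elim: deg_less_mono)
  then have "deg_less x (card A) (N * r)" using r by (metis add_diff_cancel_left')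
  then have "r = 0" using deg_less_cancel_orbit_poly[OF fin, of "card A" r] by simp
  then have D: "?D = ?Z ?D" using r by simp
  have "N = Var x * orbit_poly x Y (A - {0})"
    using orbit_poly_insert[of "A - {0}" 0 x Y] fin zero by (simp add: insert_absorb)
  then have "?Z ?D = ?Z (orbit_poly x Y (A - {0}))"
    by (simp add: partial_deriv_Var)
  also have "\<dots> = Const (\<Prod>(A - {0})) * Y ^ (card A - 1)"
    using fin zero by (simp add: orbit_poly_def prod.distrib Const_prod)
  finally show ?thesis using D by simp
qed

end

section \<open>Weighted homogeneity\<close>

text \<open>
  Weights are needed because the generators produced by one step have different degrees and serve
  as the variables of the next step.
\<close>

definition weighted_homog :: "('n::finite \<Rightarrow> nat) \<Rightarrow> nat \<Rightarrow> ('n, 'a::field) mpoly \<Rightarrow> bool" where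
  "weighted_homog w k p \<longleftrightarrow> (\<forall>e\<in>Poly_Mapping.keys p. (\<Sum>i\<in>UNIV. w i * Poly_Mapping.lookup e i) = k)"

lemma homogeneous_iff_weighted_homog: "homogeneous p \<longleftrightarrow> (\<exists>k. weighted_homog (\<lambda>_. 1) k p)"
  by (simp add: homogeneous_def weighted_homog_def monom_degree_def)

lemma weighted_homog_zero [simp]: "weighted_homog w k 0"
  by (simp add: weighted_homog_def)

lemma weighted_homog_Const: "weighted_homog w 0 (Const c)"
  by (simp add: weighted_homog_def Const_def)

lemma weighted_homog_one [simp]: "weighted_homog w 0 1"
  by (simp add: weighted_homog_def)

lemma weighted_homog_Var: "weighted_homog w (w i) (Var i)"
proof -
  have "(\<Sum>j\<in>UNIV. w j * Poly_Mapping.lookup (Poly_Mapping.single i 1) j) = (\<Sum>j\<in>UNIV. if j = i then w j else 0)"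
    by (rule sum.cong) (auto simp: lookup_single when_def)
  then show ?thesis by (simp add: weighted_homog_def Var_def)
qed

lemma weighted_homog_add: "weighted_homog w k p \<Longrightarrow> weighted_homog w k q \<Longrightarrow> weighted_homog w k (p + q)"
  unfolding weighted_homog_def using Poly_Mapping.keys_add[of p q] by blast

lemma weighted_homog_uminus: "weighted_homog w k p \<Longrightarrow> weighted_homog w k (- p)"
  by (simp add: weighted_homog_def in_keys_iff)

lemma weighted_homog_diff: "weighted_homog w k p \<Longrightarrow> weighted_homog w k q \<Longrightarrow> weighted_homog w k (p - q)"
  using weighted_homog_add[of w k p "- q"] weighted_homog_uminus[of w k q] by simp

lemma weighted_homog_mult:
  assumes "weighted_homog w k p" "weighted_homog w l q"
  shows "weighted_homog w (k + l) (p * q)"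
  unfolding weighted_homog_def
proof
  fix e assume "e \<in> Poly_Mapping.keys (p * q)"
  then obtain a b where "e = a + b" "a \<in> Poly_Mapping.keys p" "b \<in> Poly_Mapping.keys q"
    using keys_mult[of p q] by blast
  with assms show "(\<Sum>i\<in>UNIV. w i * Poly_Mapping.lookup e i) = k + l"
    by (simp add: weighted_homog_def lookup_add distrib_left sum.distrib)
qed

lemma weighted_homog_Const_mult: "weighted_homog w k p \<Longrightarrow> weighted_homog w k (Const c * p)"
  using weighted_homog_mult[OF weighted_homog_Const] by fastforce

lemma weighted_homog_power: "weighted_homog w k p \<Longrightarrow> weighted_homog w (k * m) (p ^ m)"
  by (induction m) (auto dest: weighted_homog_mult)

lemma weighted_homog_sum: "(\<And>i. i \<in> A \<Longrightarrow> weighted_homog w k (f i)) \<Longrightarrow> weighted_homog w k (sum f A)"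
  by (induction A rule: infinite_finite_induct) (simp_all add: weighted_homog_add)

lemma weighted_homog_prod: "(\<And>i. i \<in> A \<Longrightarrow> weighted_homog w (k i) (f i)) \<Longrightarrow> weighted_homog w (sum k A) (prod f A)"
  by (induction A rule: infinite_finite_induct) (simp_all add: weighted_homog_mult)

lemma weighted_homog_subst_poly:
  assumes "\<And>i. weighted_homog w (w' i) (f i)" "weighted_homog w' k p"
  shows "weighted_homog w k (subst_poly f p)"
  unfolding subst_poly_def
proof (rule weighted_homog_sum)
  fix e assume "e \<in> Poly_Mapping.keys p"
  then have "(\<Sum>i\<in>UNIV. w' i * Poly_Mapping.lookup e i) = k"
    using assms(2) by (simp add: weighted_homog_def)
  moreover have "weighted_homog w (\<Sum>i\<in>UNIV. w' i * Poly_Mapping.lookup e i)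
      (\<Prod>i\<in>UNIV. f i ^ Poly_Mapping.lookup e i)"
    by (intro weighted_homog_prod weighted_homog_power assms(1))
  ultimately show "weighted_homog w k (Const (Poly_Mapping.lookup p e) *
      (\<Prod>i\<in>UNIV. f i ^ Poly_Mapping.lookup e i))"
    by (simp add: weighted_homog_Const_mult)
qed

text \<open>
  For \<open>k = 0\<close> the truncated degree is harmless: the derivative is then \<open>0\<close>.
\<close>

lemma weighted_homog_partial_deriv:
  assumes "weighted_homog (\<lambda>_. 1) k p"
  shows "weighted_homog (\<lambda>_. 1) (k - 1) (partial_deriv j p)"
  unfolding weighted_homog_def
proof
  fix e assume "e \<in> Poly_Mapping.keys (partial_deriv j p)"
  then have "e + Poly_Mapping.single j 1 \<in> Poly_Mapping.keys p"
    by (auto simp: in_keys_iff lookup_partial_deriv)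
  then have "(\<Sum>i\<in>UNIV. Poly_Mapping.lookup (e + Poly_Mapping.single j 1) i) = k"
    using assms by (simp add: weighted_homog_def)
  moreover have "(\<Sum>i\<in>UNIV. Poly_Mapping.lookup (e + Poly_Mapping.single j 1) i) =
      (\<Sum>i\<in>UNIV. Poly_Mapping.lookup e i) + 1"
    by (simp add: lookup_add sum.distrib lookup_single when_def)
  ultimately show "(\<Sum>i\<in>UNIV. 1 * Poly_Mapping.lookup e i) = k - 1" by simp
qed

lemma weighted_homog_jacobian:
  assumes "\<And>i. weighted_homog (\<lambda>_. 1) (k i) (f i)"
  shows "weighted_homog (\<lambda>_. 1) (\<Sum>i\<in>UNIV. k i - 1) (jacobian f)"
  unfolding jacobian_def det_def
proof (rule weighted_homog_sum)
  fix p
  have "weighted_homog (\<lambda>_. 1) (\<Sum>i\<in>UNIV. k i - 1) (\<Prod>i\<in>UNIV. partial_deriv (p i) (f i))"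
    by (intro weighted_homog_prod weighted_homog_partial_deriv assms)
  then show "weighted_homog (\<lambda>_. 1) (\<Sum>i\<in>UNIV. k i - 1)
      (of_int (sign p) * (\<Prod>i\<in>UNIV. (\<chi> i j. partial_deriv j (f i)) $ i $ p i))"
    by (auto simp: sign_def weighted_homog_uminus)
qed

section \<open>Invariants of a finite group of scalings of one variable\<close>

lemma lookup_scale:
  "Poly_Mapping.lookup (subst_poly (Var(y := Const c * Var y)) q) e =
     c ^ Poly_Mapping.lookup e y * Poly_Mapping.lookup q e"
proof (induction q rule: mpoly_single_induct)
  case (single e' b)
  have "(\<Prod>i\<in>UNIV. (Var(y := Const c * Var y)) i ^ Poly_Mapping.lookup e' i) =
    (\<Prod>i\<in>UNIV. (if i = y then Const c ^ Poly_Mapping.lookup e' i else 1) * Var i ^ Poly_Mapping.lookup e' i)"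
    by (rule prod.cong) (auto simp: power_mult_distrib)
  then have "subst_poly (Var(y := Const c * Var y)) (Poly_Mapping.single e' b) =
      Const (c ^ Poly_Mapping.lookup e' y) * Poly_Mapping.single e' b"
    by (simp add: subst_poly_single prod.distrib Const_power single_eq_monomial[of e' b] mult_ac)
  then show ?case by (simp add: lookup_Const_mult lookup_single when_def del: fun_upd_apply)
qed (simp_all add: lookup_add distrib_left)

locale finite_mult_group =
  fixes M :: "'a::field set"
  assumes fin: "finite M" and nonempty: "M \<noteq> {}" and nonzero: "0 \<notin> M"
    and mult_closed: "\<And>a b. a \<in> M \<Longrightarrow> b \<in> M \<Longrightarrow> a * b \<in> M"
begin

lemma card_pos: "card M > 0"
  using fin nonempty by (simp add: card_gt_0_iff)

lemma power_card_eq_1: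
  assumes c: "c \<in> M"
  shows "c ^ card M = 1"
proof -
  have inj: "inj_on ((*) c) M" using c nonzero by (auto simp: inj_on_def)
  then have "(*) c ` M = M"
    using fin c mult_closed by (intro card_subset_eq) (auto simp: card_image)
  then have "\<Prod>M = (\<Prod>b\<in>M. c * b)" using prod.reindex[OF inj, of "\<lambda>b. b"] by (simp add: comp_def)
  also have "\<dots> = c ^ card M * \<Prod>M" by (simp add: prod.distrib)
  finally show ?thesis using nonzero fin by simp
qed

text \<open>
  An exponent killing \<open>M\<close> may be reduced modulo \<open>card M\<close>, and a nonzero remainder \<open>r\<close> would give the
  polynomial \<open>X ^ r - 1\<close> more roots than its degree allows.
\<close>

lemma card_dvd:
  assumes "\<And>c. c \<in> M \<Longrightarrow> c ^ k = 1"
  shows "card M dvd k"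
proof (rule ccontr)
  assume "\<not> card M dvd k"
  define r where "r = k mod card M"
  have r: "0 < r" "r < card M" using \<open>\<not> card M dvd k\<close> card_pos by (auto simp: r_def dvd_eq_mod_eq_0)
  have cr: "c ^ r = 1" if c: "c \<in> M" for c
  proof -
    have "1 = c ^ (card M * (k div card M) + r)" using assms[OF c] by (simp add: r_def)
    then show ?thesis using power_card_eq_1[OF c] by (simp add: power_add power_mult)
  qed
  let ?p = "monom 1 r - 1 :: 'a poly"
  have "coeff ?p r = 1" using r by simp
  then have "?p \<noteq> 0" by force
  moreover have "M \<subseteq> {c. poly ?p c = 0}" using cr by (auto simp: poly_monom)
  moreover have "degree ?p \<le> r" by (intro degree_diff_le) (simp_all add: degree_monom_le)
  ultimately have "card M \<le> r"
    using card_mono[OF poly_roots_finite[of ?p], of M] card_poly_roots_bound[of ?p] by linarith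
  then show False using r by simp
qed

text \<open>
  The order of \<open>M\<close> is prime to the characteristic: otherwise \<open>1 + X + \<dots> + X ^ (card M - 1)\<close>, which
  vanishes on \<open>M - {1}\<close>, would vanish at \<open>1\<close> as well and have more roots than its degree allows.
\<close>

lemma of_nat_card_nonzero: "of_nat (card M) \<noteq> (0 :: 'a)"
proof
  assume 0: "of_nat (card M) = (0 :: 'a)"
  let ?p = "\<Sum>k<card M. monom (1 :: 'a) k"
  have "poly ?p c = 0" if c: "c \<in> M" for c
  proof (cases "c = 1")
    case True
    then show ?thesis using 0 by (simp add: poly_sum poly_monom)
  next
    case False
    have "(\<Sum>k<card M. c ^ k) = 0"
      using power_card_eq_1[OF c] False by (simp add: geometric_sum)
    then show ?thesis by (simp add: poly_sum poly_monom)
  qed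
  then have "M \<subseteq> {c. poly ?p c = 0}" by blast
  moreover have "coeff ?p 0 = 1" using card_pos by (simp add: coeff_sum)
  then have "?p \<noteq> 0" by force
  moreover have "degree ?p \<le> card M - 1"
    by (intro degree_sum_le) (auto intro: order_trans[OF degree_monom_le])
  ultimately have "card M \<le> card M - 1"
    using card_mono[OF poly_roots_finite[of ?p], of M] card_poly_roots_bound[of ?p] by linarith
  then show False using card_pos by simp
qed

text \<open>
  A scaling multiplies each monomial by a power of the scalar, so invariants only contain monomials
  whose exponent of \<open>Var y\<close> is divisible by \<open>card M\<close>.
\<close>

lemma invariants_of_scalings:
  assumes inv: "\<And>c. c \<in> M \<Longrightarrow> subst_poly (Var(y := Const c * Var y)) q = q"
  shows "q \<in> range (subst_poly (Var(y := Var y ^ card M)))"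
proof -
  let ?P = "Var(y := Var y ^ card M)" and ?l = "Poly_Mapping.lookup"
  have "card M dvd ?l e y" if e: "e \<in> Poly_Mapping.keys q" for e
  proof (rule card_dvd)
    fix c assume "c \<in> M"
    then have "c ^ ?l e y * ?l q e = ?l q e" using inv lookup_scale[of y c q e] by simp
    then show "c ^ ?l e y = 1" using e by (simp add: in_keys_iff)
  qed
  then have "q = subst_poly ?P (\<Sum>e\<in>Poly_Mapping.keys q. Const (?l q e) *
      (\<Prod>i\<in>UNIV. Var i ^ (if i = y then ?l e i div card M else ?l e i)))"
    unfolding subst_poly_sum subst_poly_mult subst_poly_prod subst_poly_Const subst_poly_power
      subst_poly_Var
    by (subst subst_poly_Var_id[of q, symmetric], unfold subst_poly_def)
      (intro sum.cong prod.cong arg_cong2[where f = "(*)"] refl, auto simp: power_mult[symmetric])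
  then show ?thesis by blast
qed

end

section \<open>Straightening a line\<close>

text \<open>
  The elementary change of coordinates that absorbs multiples of \<open>Var x\<close>.  It fixes \<open>Var x\<close> and,
  when \<open>x = y\<close> or \<open>c y = 0\<close>, also \<open>Var y\<close>, so that changing the sign of \<open>c\<close> inverts it.
\<close>

definition shear :: "'n \<Rightarrow> 'n \<Rightarrow> ('n \<Rightarrow> nat) \<Rightarrow> ('n \<Rightarrow> 'a::field) \<Rightarrow> 'n \<Rightarrow> ('n, 'a) mpoly" where
  "shear x y k c i = (if i = x then Var x else Var i + Const (c i) * Var y ^ k i * Var x)"

lemma shear_x [simp]: "shear x y k c x = Var x"
  by (simp add: shear_def)

lemma shear_y: "x = y \<or> c y = 0 \<Longrightarrow> shear x y k c y = Var y"
  by (auto simp: shear_def)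

lemma subst_poly_shear_inverse:
  assumes "x = y \<or> c y = 0" and "\<And>i. c' i = - c i"
  shows "subst_poly (shear x y k c) (subst_poly (shear x y k c') p) = p"
proof -
  have "subst_poly (shear x y k c) (shear x y k c' i) = Var i" for i
    using shear_y[of x y c k] assms(1)
    by (cases "i = x") (simp_all add: shear_def[of x y k c' i] shear_def[of x y k c i] assms(2) Const_uminus)
  then show ?thesis by (simp add: subst_poly_subst_poly)
qed

lemma jacobian_Var [simp]: "jacobian Var = 1"
  unfolding jacobian_def
  by (subst det_triangular_rank[where r = "\<lambda>_. 0"]) (simp_all add: partial_deriv_Var)

lemma jacobian_shear:
  assumes "x = y \<or> c y = 0"
  shows "jacobian (shear x y k c) = 1"
  unfolding jacobian_def
proof (subst det_triangular_rank[where r = "\<lambda>i. if i = x \<or> i = y then 0 else 1"])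
  fix i l assume "i \<noteq> l" "(if i = x \<or> i = y then 0 else 1) \<le> (if l = x \<or> l = y then 0 else (1::nat))"
  then show "(\<chi> i j. partial_deriv j (shear x y k c i)) $ i $ l = 0"
    using assms by (auto simp: shear_def partial_deriv_Var partial_deriv_power_Var split: if_splits)
next
  show "(\<Prod>i\<in>UNIV. (\<chi> i j. partial_deriv j (shear x y k c i)) $ i $ i) = 1"
    using assms
    by (intro prod.neutral ballI) (auto simp: shear_def partial_deriv_Var partial_deriv_power_Var)
qed

lemma jacobian_upd: "jacobian (Var(x := M)) = partial_deriv x M"
proof -
  let ?A = "\<chi> i j. partial_deriv j ((Var(x := M)) i)"
  have "det ?A = (\<Prod>i\<in>UNIV. ?A $ i $ i)"
    by (rule det_triangular_rank[where r = "\<lambda>i. if i = x then 1 else 0"])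
      (auto simp: partial_deriv_Var split: if_splits)
  also have "\<dots> = (\<Prod>i\<in>UNIV. if i = x then partial_deriv x M else 1)"
    by (rule prod.cong) (auto simp: partial_deriv_Var)
  finally show ?thesis by (simp add: jacobian_def)
qed

section \<open>Invariants of an affine group of vectors\<close>

text \<open>
  Let \<open>\<beta>\<close> stand for the linear map \<open>v \<mapsto> v + l v *s b\<close>, where \<open>\<beta> i\<close> are the coordinates of \<open>b\<close> and the
  coordinate \<open>y\<close> is \<open>l\<close> itself.  Its determinant is \<open>1 + \<beta> y\<close>, composition of such maps is the operation
  in the last clause, and the transvections are the \<open>\<beta>\<close> with \<open>\<beta> y = 0\<close>.  Inverses exist
  because \<open>\<Gamma>\<close> is finite.
\<close>

definition affine_group :: "'n \<Rightarrow> ('n \<Rightarrow> 'a::field) set \<Rightarrow> bool" where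
  "affine_group y \<Gamma> \<longleftrightarrow> finite \<Gamma> \<and> (\<lambda>_. 0) \<in> \<Gamma> \<and> (\<forall>\<beta>\<in>\<Gamma>. 1 + \<beta> y \<noteq> 0) \<and>
     (\<forall>\<beta>\<in>\<Gamma>. \<forall>\<gamma>\<in>\<Gamma>. (\<lambda>i. \<beta> i + (1 + \<beta> y) * \<gamma> i) \<in> \<Gamma>)"

text \<open>
  The substitution by which \<open>\<beta>\<close> acts on variables of weights \<open>d\<close>.  For weights \<open>1\<close> it is the linear
  action; at \<open>i = y\<close> with \<open>d y = 1\<close> it scales \<open>Var y\<close> by \<open>1 + \<beta> y\<close>.
\<close>

definition affine_subst :: "'n \<Rightarrow> ('n \<Rightarrow> nat) \<Rightarrow> ('n \<Rightarrow> 'a::field) \<Rightarrow> 'n \<Rightarrow> ('n, 'a) mpoly" where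
  "affine_subst y d \<beta> i = Var i + Const (\<beta> i) * Var y ^ d i"

definition affine_invariants ::
  "'n::finite \<Rightarrow> ('n \<Rightarrow> nat) \<Rightarrow> ('n \<Rightarrow> 'a::field) set \<Rightarrow> ('n, 'a) mpoly set" where
  "affine_invariants y d \<Gamma> = {q. \<forall>\<beta>\<in>\<Gamma>. subst_poly (affine_subst y d \<beta>) q = q}"

text \<open>
  Algebraically independent generators \<open>P\<close> of the algebra \<open>R\<close>, homogeneous for the weights \<open>d\<close>, whose
  Jacobian determinant is a power of \<open>Var y\<close> up to a nonzero constant.
\<close>

definition basic_generators ::
  "'n::finite \<Rightarrow> ('n \<Rightarrow> nat) \<Rightarrow> ('n, 'a::field) mpoly set \<Rightarrow> ('n \<Rightarrow> ('n, 'a) mpoly) \<Rightarrow> bool" where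
  "basic_generators y d R P \<longleftrightarrow> inj (subst_poly P) \<and> range (subst_poly P) = R \<and>
     (\<forall>i. \<exists>k. weighted_homog d k (P i)) \<and> (\<exists>c m. c \<noteq> 0 \<and> jacobian P = Const c * Var y ^ m)"

text \<open>
  The induction step in the abstract.  If all invariants of \<open>\<Gamma>\<close> are polynomials in the \<open>f i\<close>, and \<open>\<Gamma>\<close>
  acts on the \<open>f i\<close> as \<open>\<phi> ` \<Gamma>\<close> acts on variables, then generators for \<open>\<phi> ` \<Gamma>\<close> yield generators for \<open>\<Gamma>\<close>.
\<close>

lemma basic_generators_pullback:
  assumes good: "basic_generators y d' (affine_invariants y d' (\<phi> ` \<Gamma>)) P"
    and equiv: "\<And>\<beta> i. \<beta> \<in> \<Gamma> \<Longrightarrow> subst_poly (affine_subst y d \<beta>) (f i) = subst_poly f (affine_subst y d' (\<phi> \<beta>) i)"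
    and inj: "inj (subst_poly f)"
    and sub: "affine_invariants y d \<Gamma> \<subseteq> range (subst_poly f)"
    and hom: "\<And>i. weighted_homog d (d' i) (f i)"
    and fy: "f y = Var y ^ r"
    and jac: "jacobian f = Const c * Var y ^ m" "c \<noteq> 0"
  shows "basic_generators y d (affine_invariants y d \<Gamma>) (\<lambda>i. subst_poly f (P i))"
proof -
  have comp: "subst_poly (\<lambda>i. subst_poly f (P i)) q = subst_poly f (subst_poly P q)" for q
    by (simp add: subst_poly_subst_poly)
  have inv: "subst_poly f q \<in> affine_invariants y d \<Gamma> \<longleftrightarrow> q \<in> affine_invariants y d' (\<phi> ` \<Gamma>)" for q
    using inj by (auto simp: affine_invariants_def subst_poly_intertwine[OF equiv] inj_eq)
  have range: "range (subst_poly P) = affine_invariants y d' (\<phi> ` \<Gamma>)"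
    and injP: "inj (subst_poly P)" and homP: "\<forall>i. \<exists>k. weighted_homog d' k (P i)"
    using good by (auto simp: basic_generators_def)
  obtain c' m' where jacP: "c' \<noteq> 0" "jacobian P = Const c' * Var y ^ m'"
    using good by (auto simp: basic_generators_def)
  have "range (\<lambda>q. subst_poly f (subst_poly P q)) = subst_poly f ` affine_invariants y d' (\<phi> ` \<Gamma>)"
    by (simp add: image_image flip: range)
  also have "\<dots> = affine_invariants y d \<Gamma>" using sub inv by blast
  finally have "range (subst_poly (\<lambda>i. subst_poly f (P i))) = affine_invariants y d \<Gamma>"
    by (simp add: comp)
  moreover have "inj (subst_poly (\<lambda>i. subst_poly f (P i)))"
  proof -
    have "subst_poly (\<lambda>i. subst_poly f (P i)) = subst_poly f \<circ> subst_poly P" by (rule ext) (simp add: comp)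
    then show ?thesis using inj_compose[OF inj injP] by simp
  qed
  moreover have "\<exists>k. weighted_homog d k (subst_poly f (P i))" for i
    using homP weighted_homog_subst_poly[where w = d and w' = d' and f = f, OF hom] by blast
  moreover have "jacobian (\<lambda>i. subst_poly f (P i)) = Const (c' * c) * Var y ^ (r * m' + m)"
    by (simp add: jacobian_subst_poly jacP jac fy Const_mult power_add mult_ac flip: power_mult)
  moreover have "c' * c \<noteq> 0" using jacP jac by simp
  ultimately show ?thesis unfolding basic_generators_def by blast
qed

text \<open>
  Coordinates adapted to the line spanned by \<open>u\<close>, where \<open>u x = 1\<close>: a shear makes the elements \<open>a * u\<close> of
  the group move \<open>Var x\<close> only, and then \<open>Var x\<close> is replaced by an invariant \<open>M\<close> of these elements.
\<close>

definition line_coords ::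
  "'n \<Rightarrow> 'n \<Rightarrow> ('n \<Rightarrow> nat) \<Rightarrow> ('n \<Rightarrow> 'a::field) \<Rightarrow> ('n, 'a) mpoly \<Rightarrow> 'n \<Rightarrow> ('n, 'a) mpoly" where
  "line_coords x y d u M i = (if i = x then M else Var i - Const (u i) * Var y ^ (d i - d x) * Var x)"

text \<open>
  The line spanned by \<open>u\<close> consists of transvections when \<open>u y = 0\<close> and of reflections when \<open>x = y\<close>.  The
  weight of \<open>x\<close> must be least among the coordinates that \<open>u\<close> involves, for the shear has to be
  polynomial and weighted homogeneous.
\<close>

lemma line_coords:
  fixes M :: "('n::finite, 'a::field) mpoly"
  assumes xy: "x = y \<or> u y = 0" and ux: "u x = 1"
    and du: "\<And>i. u i \<noteq> 0 \<Longrightarrow> d x \<le> d i"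
    and M: "\<And>k c. x = y \<or> c y = 0 \<Longrightarrow> subst_poly (shear x y k c) M = M"
    and injM: "inj (subst_poly (Var(x := M)))"
    and dy: "d y = 1"
  shows inj_line_coords: "inj (subst_poly (line_coords x y d u M))"
    and jacobian_line_coords:
      "jacobian (line_coords x y d u M) = subst_poly (shear x y (\<lambda>i. d i - d x) (\<lambda>i. - u i)) (partial_deriv x M)"
    and invariants_line_coords:
      "\<lbrakk>\<And>q. (\<And>a. a \<in> A \<Longrightarrow> subst_poly (Var(x := Var x + Const a * Var y ^ d x)) q = q)
            \<Longrightarrow> q \<in> range (subst_poly (Var(x := M)));
        \<And>a. a \<in> A \<Longrightarrow> (\<lambda>i. a * u i) \<in> \<Gamma>;
        \<And>a i. \<lbrakk>a \<in> A; x = y\<rbrakk> \<Longrightarrow> (1 + a) ^ d i = 1 + a\<rbrakk> \<Longrightarrow>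
       affine_invariants y d \<Gamma> \<subseteq> range (subst_poly (line_coords x y d u M))"
    and weighted_homog_line_coords: 
      "\<And>i. weighted_homog d k M \<Longrightarrow> weighted_homog d (if i = x then k else d i) (line_coords x y d u M i)"
proof -
  let ?k = "\<lambda>i. d i - d x"
  let ?f = "line_coords x y d u M" and ?E = "shear x y ?k (\<lambda>i. - u i)" and ?E' = "shear x y ?k u"
  have xy': "x = y \<or> - u y = 0" using xy by simp
  have "?f i = subst_poly ?E ((Var(x := M)) i)" for i
    using M[of "\<lambda>i. - u i" ?k] xy by (simp add: line_coords_def shear_def Const_uminus)
  then have f: "?f = (\<lambda>i. subst_poly ?E ((Var(x := M)) i))" by blast
  have f': "subst_poly ?f q = subst_poly ?E (subst_poly (Var(x := M)) q)" for q
    by (simp only: f subst_poly_subst_poly)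
  have EE': "subst_poly ?E (subst_poly ?E' p) = p" "subst_poly ?E' (subst_poly ?E p) = p" for p
    using subst_poly_shear_inverse[of x y "\<lambda>i. - u i" u ?k p]
      subst_poly_shear_inverse[of x y u "\<lambda>i. - u i" ?k p] xy by simp_all
  then have injE: "inj (subst_poly ?E)" by (metis injI)
  show "inj (subst_poly ?f)"
  proof -
    have "subst_poly ?f = subst_poly ?E \<circ> subst_poly (Var(x := M))" by (rule ext) (simp only: f' comp_def)
    then show ?thesis using inj_compose[OF injE injM] by simp
  qed
  show "jacobian ?f = subst_poly ?E (partial_deriv x M)"
    unfolding f by (simp only: jacobian_subst_poly jacobian_upd jacobian_shear[where c = "\<lambda>i. - u i", OF xy'] mult_1_right)
  show "weighted_homog d (if i = x then k else d i) (?f i)" if "weighted_homog d k M" for i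
  proof (cases "i = x")
    case False
    have "weighted_homog d (d i) (Const (u i) * Var y ^ (d i - d x) * Var x)"
    proof (cases "u i = 0")
      case nz: False
      have "weighted_homog d (d y * (d i - d x) + d x) (Const (u i) * Var y ^ (d i - d x) * Var x)"
        by (intro weighted_homog_mult weighted_homog_power weighted_homog_Const_mult weighted_homog_Var)
      then show ?thesis using dy du[OF nz] by simp
    qed simp
    then show ?thesis using False by (simp add: line_coords_def weighted_homog_diff weighted_homog_Var)
  qed (use that in \<open>simp add: line_coords_def\<close>)
  show "affine_invariants y d \<Gamma> \<subseteq> range (subst_poly ?f)"
    if inv: "\<And>q. (\<And>a. a \<in> A \<Longrightarrow> subst_poly (Var(x := Var x + Const a * Var y ^ d x)) q = q)
            \<Longrightarrow> q \<in> range (subst_poly (Var(x := M)))"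
      and A: "\<And>a. a \<in> A \<Longrightarrow> (\<lambda>i. a * u i) \<in> \<Gamma>"
      and pow: "\<And>a i. \<lbrakk>a \<in> A; x = y\<rbrakk> \<Longrightarrow> (1 + a) ^ d i = 1 + a"
  proof
    fix q assume q: "q \<in> affine_invariants y d \<Gamma>"
    have "subst_poly ?E' q \<in> range (subst_poly (Var(x := M)))"
    proof (rule inv)
      fix a assume a: "a \<in> A"
      let ?R = "Var(x := Var x + Const a * Var y ^ d x)" and ?t = "affine_subst y d (\<lambda>i. a * u i)"
      \<comment> \<open>In the sheared coordinates, the element \<open>a * u\<close> moves \<open>Var x\<close> alone.\<close>
      have "subst_poly ?t (?E i) = subst_poly ?E (?R i)" for i
      proof (cases "i = x")
        case True
        have "subst_poly ?E (Var y) = Var y" using shear_y[of x y "\<lambda>i. - u i" ?k] xy by simp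
        then show ?thesis using True ux by (simp add: affine_subst_def)
      next
        case False
        show ?thesis
        proof (cases "u i = 0")
          case nz: False
          have split: "(Var y ^ d i :: ('n, 'a) mpoly) = Var y ^ (d i - d x) * Var y ^ d x"
            using du[OF nz] by (simp flip: power_add)
          show ?thesis
          proof (cases "x = y")
            case True
            have "subst_poly ?t (Var y) = Const (1 + a) * Var y"
              using True ux dy by (simp add: affine_subst_def Const_add distrib_right)
            moreover have yx: "Var y ^ (d i - d x) * Var x = (Var y ^ d i :: ('n, 'a) mpoly)"
              using split True dy by simp
            ultimately have "subst_poly ?t (Var y ^ (d i - d x) * Var x) = Const (1 + a) * Var y ^ d i"
              using pow[OF a True, of i]
              by (metis Const_power power_mult_distrib subst_poly_power)
            then have *: "subst_poly ?t (Const (u i) * (Var y ^ (d i - d x) * Var x)) =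
                Const (u i) * (Const (1 + a) * Var y ^ d i)" by simp
            have "subst_poly ?t (?E i) = subst_poly ?t (Var i) -
                subst_poly ?t (Const (u i) * (Var y ^ (d i - d x) * Var x))"
              using False by (simp add: shear_def Const_uminus mult.assoc)
            also have "\<dots> = Var i + Const (a * u i) * Var y ^ d i
                - Const (u i) * (Const (1 + a) * Var y ^ d i)"
              unfolding * by (simp add: affine_subst_def)
            also have "\<dots> = Var i - Const (u i) * (Var y ^ (d i - d x) * Var x)"
              
              unfolding yx by (simp add: Const_add Const_mult algebra_simps)
            also have "\<dots> = subst_poly ?E (?R i)"
              using False by (simp add: shear_def Const_uminus mult.assoc)
            finally show ?thesis .
          next
            case neq: False
            then have "u y = 0" using xy by simp
            then show ?thesis
              using False neq ux by (simp add: shear_def affine_subst_def Const_uminus Const_mult split algebra_simps)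
          qed
        qed (simp add: False shear_def affine_subst_def)
      qed
      then have "subst_poly ?t (subst_poly ?E (subst_poly ?E' q)) =
          subst_poly ?E (subst_poly ?R (subst_poly ?E' q))"
        by (rule subst_poly_intertwine)
      moreover have "subst_poly ?t q = q" using q A[OF a] by (simp add: affine_invariants_def)
      ultimately show "subst_poly ?R (subst_poly ?E' q) = subst_poly ?E' q"
        by (metis EE')
    qed
    then obtain r where r: "subst_poly ?E' q = subst_poly (Var(x := M)) r" by blast
    have "subst_poly ?f r = q" unfolding f' r[symmetric] by (rule EE'(1))
    then show "q \<in> range (subst_poly ?f)" by blast
  qed
qed

lemma affine_group_right_translate:
  assumes "affine_group y \<Gamma>" "\<beta> \<in> \<Gamma>" "\<delta> \<in> \<Gamma>"
  obtains \<alpha> where "\<alpha> \<in> \<Gamma>" "\<delta> = (\<lambda>i. \<alpha> i + (1 + \<alpha> y) * \<beta> i)"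
proof -
  let ?h = "\<lambda>\<alpha> i. \<alpha> i + (1 + \<alpha> y) * \<beta> i"
  have "inj_on ?h \<Gamma>"
  proof (rule inj_onI)
    fix \<alpha> \<alpha>' assume "?h \<alpha> = ?h \<alpha>'"
    then have e: "?h \<alpha> i = ?h \<alpha>' i" for i by meson
    have "(1 + \<alpha> y) * (1 + \<beta> y) = (1 + \<alpha>' y) * (1 + \<beta> y)"
      using e[of y] by (simp add: algebra_simps)
    then have "\<alpha> y = \<alpha>' y" using assms by (simp add: affine_group_def)
    then show "\<alpha> = \<alpha>'" using e by (simp add: fun_eq_iff)
  qed
  then have "?h ` \<Gamma> = \<Gamma>"
    using assms by (intro card_subset_eq) (auto simp: card_image affine_group_def)
  then show ?thesis using assms(3) that by blast
qed

text \<open>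
  Conjugating the transvection \<open>\<theta>\<close> by \<open>\<gamma>\<close> multiplies it by \<open>1 + \<gamma> y\<close>.
\<close>

lemma affine_group_scale_transvection:
  assumes G: "affine_group y \<Gamma>" and g: "\<gamma> \<in> \<Gamma>" and t: "\<theta> \<in> \<Gamma>" "\<theta> y = 0"
  shows "(\<lambda>i. (1 + \<gamma> y) * \<theta> i) \<in> \<Gamma>"
proof -
  have "(\<lambda>i. \<gamma> i + (1 + \<gamma> y) * \<theta> i) \<in> \<Gamma>" using assms by (auto simp: affine_group_def)
  then obtain \<alpha> where a: "\<alpha> \<in> \<Gamma>"
    and e: "(\<lambda>i. \<gamma> i + (1 + \<gamma> y) * \<theta> i) = (\<lambda>i. \<alpha> i + (1 + \<alpha> y) * \<gamma> i)"
    using affine_group_right_translate[OF G g] by metis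
  have e': "\<gamma> i + (1 + \<gamma> y) * \<theta> i = \<alpha> i + (1 + \<alpha> y) * \<gamma> i" for i using e by meson
  have "\<alpha> y * (1 + \<gamma> y) = 0" using e'[of y] t by (simp add: algebra_simps)
  then have "\<alpha> y = 0" using G g by (auto simp: affine_group_def)
  then have "\<alpha> = (\<lambda>i. (1 + \<gamma> y) * \<theta> i)" using e' by (auto simp: fun_eq_iff)
  then show ?thesis using a by simp
qed

text \<open>
  Elements with the same determinant differ by a transvection, so here the determinant separates
  elements.  The group is therefore commutative, and \<open>\<beta> * \<gamma> = \<gamma> * \<beta>\<close> says that \<open>\<beta>\<close> and \<open>\<gamma>\<close> are proportional.
\<close>

lemma affine_group_without_transvections:
  assumes G: "affine_group y \<Gamma>" and none: "\<And>\<theta>. \<lbrakk>\<theta> \<in> \<Gamma>; \<theta> y = 0\<rbrakk> \<Longrightarrow> \<theta> = (\<lambda>_. 0)"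
  obtains u where "u y = 1" "\<And>\<beta> i. \<beta> \<in> \<Gamma> \<Longrightarrow> \<beta> i = \<beta> y * u i"
proof -
  have chi: "\<beta> = \<gamma>" if b: "\<beta> \<in> \<Gamma>" and c: "\<gamma> \<in> \<Gamma>" and e: "\<beta> y = \<gamma> y" for \<beta> \<gamma>
  proof -
    obtain \<alpha> where a: "\<alpha> \<in> \<Gamma>" "\<beta> = (\<lambda>i. \<alpha> i + (1 + \<alpha> y) * \<gamma> i)"
      using affine_group_right_translate[OF G c b] by metis
    then have "\<alpha> y * (1 + \<gamma> y) = 0" using e by (simp add: algebra_simps)
    then have "\<alpha> y = 0" using G c by (auto simp: affine_group_def)
    then have "\<alpha> = (\<lambda>_. 0)" using none a by blast
    then show ?thesis using a by simp
  qed
  show ?thesis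
  proof (cases "\<Gamma> = {\<lambda>_. 0}")
    case True
    then show ?thesis using that[of "\<lambda>_. 1"] by simp
  next
    case False
    then obtain \<gamma> where c: "\<gamma> \<in> \<Gamma>" "\<gamma> \<noteq> (\<lambda>_. 0)" using G by (auto simp: affine_group_def)
    then have nz: "\<gamma> y \<noteq> 0" using none by blast
    have "\<beta> i = \<beta> y * (\<gamma> i / \<gamma> y)" if b: "\<beta> \<in> \<Gamma>" for \<beta> i
    proof -
      have "(\<lambda>i. \<beta> i + (1 + \<beta> y) * \<gamma> i) = (\<lambda>i. \<gamma> i + (1 + \<gamma> y) * \<beta> i)"
        using G b c by (intro chi) (auto simp: affine_group_def algebra_simps)
      then have "\<beta> i + (1 + \<beta> y) * \<gamma> i = \<gamma> i + (1 + \<gamma> y) * \<beta> i" by meson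
      then show ?thesis using nz by (simp add: field_simps)
    qed
    then show ?thesis using that[of "\<lambda>i. \<gamma> i / \<gamma> y"] nz by simp
  qed
qed


lemma (in transvection_line) scale_A:
  assumes "c \<noteq> 0" "\<And>a. a \<in> A \<Longrightarrow> c * a \<in> A"
  shows "(*) c ` A = A" "inj_on ((*) c) B"
proof -
  show inj: "inj_on ((*) c) B" for B using assms(1) by (auto intro: inj_onI)
  show "(*) c ` A = A"
    using fin assms(2) by (intro card_subset_eq) (auto simp: card_image[OF inj])
qed

text \<open>
  Multiplication by \<open>c\<close> permutes \<open>A - {0}\<close>; comparing the products gives \<open>c ^ (card A - 1) = 1\<close>.  This
  is why multiplying a weight by \<open>card A\<close> does not change the powers of the determinants.
\<close>

lemma (in transvection_line) power_card_A:
  assumes "c \<noteq> 0" "\<And>a. a \<in> A \<Longrightarrow> c * a \<in> A"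
  shows "c ^ card A = c"
proof -
  have "(*) c ` (A - {0}) = A - {0}" using scale_A[OF assms] assms(1) by (auto simp: image_set_diff)
  then have "\<Prod>(A - {0}) = (\<Prod>a\<in>A - {0}. c * a)"
    using prod.reindex[OF scale_A(2)[OF assms, of "A - {0}"], where g = "\<lambda>a. a"] by (simp add: comp_def)
  also have "\<dots> = c ^ (card A - 1) * \<Prod>(A - {0})" using fin zero by (simp add: prod.distrib)
  finally have "c ^ (card A - 1) = 1" using fin by simp
  then show ?thesis using card_A_pos by (metis Suc_diff_1 mult_1_right power_Suc)
qed

lemma (in transvection_line) orbit_value_scale:
  assumes "c \<noteq> 0" "\<And>a. a \<in> A \<Longrightarrow> c * a \<in> A"
  shows "orbit_value (c * b) = c * orbit_value b"
proof -
  have "orbit_value (c * b) = (\<Prod>a\<in>A. c * b + c * a)"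
    using prod.reindex[OF scale_A(2)[OF assms, of A], where g = "\<lambda>a. c * b + a"] scale_A(1)[OF assms]
    by (simp add: orbit_value_def)
  also have "\<dots> = c ^ card A * orbit_value b"
    by (simp add: orbit_value_def prod.distrib flip: distrib_left)
  finally show ?thesis by (simp add: power_card_A[OF assms])
qed

lemma power_diff_eq_1:
  fixes c :: "'a::field"
  assumes "c \<noteq> 0" "c ^ a = c" "c ^ b = c" "a \<le> b"
  shows "c ^ (b - a) = 1"
  using assms by (simp add: power_diff)

text \<open>
  The group lies on one line, and after straightening this line it only scales \<open>Var y\<close>, by the finite
  group of the scalars \<open>1 + \<beta> y\<close>.  Replacing \<open>Var y\<close> by \<open>Var y ^ e\<close>, where \<open>e\<close> is the order of that group,
  leaves nothing to act: the elements of \<open>\<Gamma>\<close> all map to the zero vector, and the variables are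
  generators.
\<close>

lemma affine_group_invariants_without_transvections:
  fixes \<Gamma> :: "('n::finite \<Rightarrow> 'a::field) set"
  assumes G: "affine_group y \<Gamma>" and dy: "d y = 1" and dpos: "\<And>i. 0 < d i"
    and chi: "\<And>\<beta> i. \<beta> \<in> \<Gamma> \<Longrightarrow> (1 + \<beta> y) ^ d i = 1 + \<beta> y"
    and none: "\<And>\<theta>. \<lbrakk>\<theta> \<in> \<Gamma>; \<theta> y = 0\<rbrakk> \<Longrightarrow> \<theta> = (\<lambda>_. 0)"
  shows "\<exists>P. basic_generators y d (affine_invariants y d \<Gamma>) P"
proof -
  obtain u where uy: "u y = 1" and u: "\<And>\<beta> i. \<beta> \<in> \<Gamma> \<Longrightarrow> \<beta> i = \<beta> y * u i"
    using affine_group_without_transvections[OF G none] by metis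
  let ?A = "(\<lambda>\<beta>. \<beta> y) ` \<Gamma>"
  interpret finite_mult_group "(\<lambda>\<beta>. 1 + \<beta> y) ` \<Gamma>"
  proof
    fix a b assume "a \<in> (\<lambda>\<beta>. 1 + \<beta> y) ` \<Gamma>" "b \<in> (\<lambda>\<beta>. 1 + \<beta> y) ` \<Gamma>"
    then obtain \<beta> \<gamma> where bc: "\<beta> \<in> \<Gamma>" "\<gamma> \<in> \<Gamma>" "a = 1 + \<beta> y" "b = 1 + \<gamma> y" by blast
    then have "(\<lambda>i. \<beta> i + (1 + \<beta> y) * \<gamma> i) \<in> \<Gamma>" using G by (simp add: affine_group_def)
    moreover have "a * b = 1 + (\<beta> y + (1 + \<beta> y) * \<gamma> y)" using bc by (simp add: algebra_simps)
    ultimately show "a * b \<in> (\<lambda>\<beta>. 1 + \<beta> y) ` \<Gamma>" 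
      by (intro image_eqI[where x = "\<lambda>i. \<beta> i + (1 + \<beta> y) * \<gamma> i"]) simp_all
  qed (use G in \<open>auto simp: affine_group_def\<close>)
  define e where "e = card ((\<lambda>\<beta>. 1 + \<beta> y) ` \<Gamma>)"
  define f where "f = line_coords y y d u (Var y ^ e)"
  have epos: "0 < e" using card_pos by (simp add: e_def)
  have u0: "u i \<noteq> 0 \<Longrightarrow> d y \<le> d i" for i using dpos[of i] dy by simp
  have shear: "subst_poly (shear y y k c) (Var y ^ e) = Var y ^ e" for k c by simp
  have injM: "inj (subst_poly (Var(y := Var y ^ e)))"
    by (rule subst_poly_upd_inj[OF Var_power_mult_eq_0]) (use epos in \<open>simp_all add: zero_power\<close>)
  note coords = line_coords[where x = y and y = y and u = u and d = d and M = "Var y ^ e",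
      OF _ uy u0 shear injM dy, folded f_def, simplified]
  have fy: "f y = Var y ^ e" by (simp add: f_def line_coords_def)
  have fi: "f i = Var i - Const (u i) * Var y ^ d i" if "i \<noteq> y" for i
  proof -
    have "Var y ^ (d i - d y) * Var y = (Var y ^ d i :: ('n, 'a) mpoly)"
      using dpos[of i] dy by (metis One_nat_def Suc_diff_1 power_Suc2)
    then show ?thesis using that by (simp add: f_def line_coords_def mult.assoc)
  qed
  have "basic_generators y d (affine_invariants y d \<Gamma>) (\<lambda>i. subst_poly f (Var i))"
  proof (rule basic_generators_pullback[where d' = "d(y := e)" and \<phi> = "\<lambda>_ _. 0" and r = e])
    have zero_subst: "affine_subst y (d(y := e)) (\<lambda>_. 0) = (Var :: _ \<Rightarrow> ('n, 'a) mpoly)" by (rule ext) (simp add: affine_subst_def)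
    have J: "\<exists>c m. c \<noteq> 0 \<and> jacobian Var = Const (c :: 'a) * Var y ^ m"
      by (intro exI[of _ 1] exI[of _ 0]) simp
    show "basic_generators y (d(y := e)) (affine_invariants y (d(y := e)) ((\<lambda>_ _. 0) ` \<Gamma>)) (Var :: _ \<Rightarrow> ('n, 'a) mpoly)"
      unfolding basic_generators_def
      by (intro conjI J) (auto simp: affine_invariants_def zero_subst inj_def intro: weighted_homog_Var)
    show "subst_poly (affine_subst y d \<beta>) (f i) = subst_poly f (affine_subst y (d(y := e)) (\<lambda>_. 0) i)"
      if b: "\<beta> \<in> \<Gamma>" for \<beta> i
    proof -
      let ?c = "1 + \<beta> y"
      have ty: "subst_poly (affine_subst y d \<beta>) (Var y) = Const ?c * Var y"
        by (simp add: affine_subst_def dy Const_add distrib_right)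
      show ?thesis
      proof (cases "i = y")
        case True
        have "?c ^ e = 1" unfolding e_def using power_card_eq_1 b by blast
        then have "subst_poly (affine_subst y d \<beta>) (Var y ^ e) = Var y ^ e"
          by (simp only: subst_poly_power ty power_mult_distrib Const_power[symmetric]) simp
        then show ?thesis by (simp add: True fy zero_subst)
      next
        case False
        have "subst_poly (affine_subst y d \<beta>) (Var y ^ d i) = Const ?c * Var y ^ d i"
          using chi[OF b, of i]
          by (simp only: subst_poly_power ty power_mult_distrib Const_power[symmetric])
        then have "subst_poly (affine_subst y d \<beta>) (f i) =
            Var i + Const (\<beta> y * u i) * Var y ^ d i - Const (u i) * (Const ?c * Var y ^ d i)"
          using u[OF b, of i] by (simp add: fi[OF False] affine_subst_def del: subst_poly_power)
        also have "\<dots> = f i" by (simp add: fi[OF False] Const_add Const_mult algebra_simps)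
        finally show ?thesis by (simp add: zero_subst)
      qed
    qed
    show "inj (subst_poly f)" by (rule coords)
    show "affine_invariants y d \<Gamma> \<subseteq> range (subst_poly f)"
    proof (rule coords(3)[of ?A])
      fix q assume q: "\<And>a. a \<in> ?A \<Longrightarrow> subst_poly (Var(y := Var y + Const a * Var y ^ d y)) q = q"
      show "q \<in> range (subst_poly (Var(y := Var y ^ e)))"
        unfolding e_def
      proof (rule invariants_of_scalings)
        fix c assume "c \<in> (\<lambda>\<beta>. 1 + \<beta> y) ` \<Gamma>"
        then obtain \<beta> where "\<beta> \<in> \<Gamma>" "c = 1 + \<beta> y" by blast
        then show "subst_poly (Var(y := Const c * Var y)) q = q"
          using q[of "\<beta> y"] dy by (simp add: Const_add distrib_right del: fun_upd_apply)
      qed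
    next
      fix a assume "a \<in> ?A"
      then obtain \<beta> where b: "\<beta> \<in> \<Gamma>" "a = \<beta> y" by blast
      then have "(\<lambda>i. a * u i) = \<beta>" using u[OF b(1), symmetric] by (intro ext) simp
      then show "(\<lambda>i. a * u i) \<in> \<Gamma>" using b by simp
    next
      fix a i assume "a \<in> ?A"
      then show "(1 + a) ^ d i = 1 + a" using chi by blast
    qed
    show "weighted_homog d ((d(y := e)) i) (f i)" for i
      using coords(4)[of e i] weighted_homog_power[OF weighted_homog_Var[of d y], of e] dy by (auto split: if_splits)
    show "f y = Var y ^ e" by (rule fy)
    show "jacobian f = Const (of_nat e) * Var y ^ (e - 1)"
      by (simp add: coords(2) partial_deriv_power_Var Const_of_nat flip: Const_of_nat)
    show "of_nat e \<noteq> (0 :: 'a)" unfolding e_def by (rule of_nat_card_nonzero)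
  qed
  then show ?thesis by blast
qed


text \<open>
  Induction on the order of the group.  Pick a transvection and the full group \<open>A\<close> of its multiples in
  \<open>\<Gamma>\<close>, and pass to coordinates adapted to this line with \<open>M\<close> the orbit polynomial.  Since the orbit
  polynomial is additive, the new coordinates are again moved by constant multiples of powers of
  \<open>Var y\<close>, and the line \<open>A\<close> is now in the kernel of the action.  The hypothesis on powers of
  determinants makes the action of \<open>\<Gamma>\<close> compatible with composition and with the shear.
\<close>

theorem affine_group_invariants:
  fixes \<Gamma> :: "('n::finite \<Rightarrow> 'a::field) set"
  assumes "affine_group y \<Gamma>" "d y = 1" "\<And>i. 0 < d i"
    "\<And>\<beta> i. \<beta> \<in> \<Gamma> \<Longrightarrow> (1 + \<beta> y) ^ d i = 1 + \<beta> y"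
  shows "\<exists>P. basic_generators y d (affine_invariants y d \<Gamma>) P"
  using assms
proof (induction "card \<Gamma>" arbitrary: \<Gamma> d rule: less_induct)
  case less
  note G = less.prems(1) and dy = less.prems(2) and dpos = less.prems(3) and chi = less.prems(4)
  show ?case
  proof (cases "\<exists>\<theta>\<in>\<Gamma>. \<theta> y = 0 \<and> \<theta> \<noteq> (\<lambda>_. 0)")
    case False
    show ?thesis
      by (rule affine_group_invariants_without_transvections) (use G dy dpos chi False in blast)+
  next
    case True
    then obtain \<theta> where \<theta>: "\<theta> \<in> \<Gamma>" "\<theta> y = 0" "\<theta> \<noteq> (\<lambda>_. 0)" by blast
    then obtain i0 where "\<theta> i0 \<noteq> 0" by blast
    \<comment> \<open>Least weight among the coordinates moved by \<open>\<theta>\<close>, as the shear requires.\<close>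
    then obtain x where x: "\<theta> x \<noteq> 0" "\<And>i. \<theta> i \<noteq> 0 \<Longrightarrow> d x \<le> d i"
      using ex_has_least_nat[of "\<lambda>i. \<theta> i \<noteq> 0" i0 d] by blast
    then have xy: "x \<noteq> y" using \<theta>(2) by auto
    define u where "u i = \<theta> i / \<theta> x" for i
    define A where "A = {a. (\<lambda>i. a * u i) \<in> \<Gamma>}"
    have ux: "u x = 1" and uy: "u y = 0" using x \<theta>(2) by (simp_all add: u_def)
    have du: "d x \<le> d i" if "u i \<noteq> 0" for i using x(2)[of i] that by (simp add: u_def)
    have injA: "inj (\<lambda>a i. a * u i)" using ux by (metis (no_types, lifting) injI mult_1_right)
    have mul: "(\<lambda>i. \<beta> i + (1 + \<beta> y) * \<gamma> i) \<in> \<Gamma>" if "\<beta> \<in> \<Gamma>" "\<gamma> \<in> \<Gamma>" for \<beta> \<gamma>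
      using G that by (simp add: affine_group_def)
    have "transvection_line x y A"
    proof
      have "A = (\<lambda>a i. a * u i) -` \<Gamma>" by (auto simp: A_def)
      then show "finite A" using G injA by (simp add: affine_group_def finite_vimageI)
      show "0 \<in> A" using G by (simp add: A_def affine_group_def)
      show "a + b \<in> A" if "a \<in> A" "b \<in> A" for a b
        using mul[of "\<lambda>i. a * u i" "\<lambda>i. b * u i"] that uy by (simp add: A_def distrib_right)
    qed (rule xy)
    then interpret transvection_line x y "d x" A .
    have scale: "(1 + \<beta> y) * a \<in> A" if "\<beta> \<in> \<Gamma>" "a \<in> A" for \<beta> a
      using affine_group_scale_transvection[OF G that(1), of "\<lambda>i. a * u i"] that(2) uy
      by (simp add: A_def mult.assoc)
    have chi0: "1 + \<beta> y \<noteq> 0" if "\<beta> \<in> \<Gamma>" for \<beta> using G that by (simp add: affine_group_def)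
    define f where "f = line_coords x y d u N"
    \<comment> \<open>The vector by which \<open>\<beta>\<close> moves the new coordinates.\<close>
    define \<phi> where "\<phi> \<beta> i = (if i = x then orbit_value (\<beta> x) else \<beta> i - u i * \<beta> x)" for \<beta> i
    define d' where "d' = d(x := d x * card A)"
    have fy: "f y = Var y" using xy uy by (simp add: f_def line_coords_def)
    have fx: "f x = N" by (simp add: f_def line_coords_def)
    have \<phi>y: "\<phi> \<beta> y = \<beta> y" for \<beta> using xy uy by (simp add: \<phi>_def)
    have \<phi>0: "\<phi> (\<lambda>_. 0) = (\<lambda>_. 0)" using orbit_value_at_A[OF zero] by (auto simp: \<phi>_def fun_eq_iff)
    \<comment> \<open>The chosen transvection becomes trivial, so the image of the group is smaller.\<close>
    have \<phi>\<theta>: "\<phi> \<theta> = (\<lambda>_. 0)"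
    proof
      fix i
      have "(\<lambda>i. \<theta> x * u i) = \<theta>" using x by (simp add: u_def)
      then have "\<theta> x \<in> A" using \<theta>(1) by (simp add: A_def)
      then show "\<phi> \<theta> i = 0" using orbit_value_at_A x by (simp add: \<phi>_def u_def)
    qed
    have "affine_group y (\<phi> ` \<Gamma>)"
      unfolding affine_group_def
    proof (intro conjI ballI)
      show "finite (\<phi> ` \<Gamma>)" using G by (simp add: affine_group_def)
      show "(\<lambda>_. 0) \<in> \<phi> ` \<Gamma>" using \<phi>\<theta> \<theta>(1) by (metis image_eqI)
      show "1 + \<beta> y \<noteq> 0" if "\<beta> \<in> \<phi> ` \<Gamma>" for \<beta> using that chi0 \<phi>y by auto
      show "(\<lambda>i. \<beta>' i + (1 + \<beta>' y) * \<gamma>' i) \<in> \<phi> ` \<Gamma>" if "\<beta>' \<in> \<phi> ` \<Gamma>" "\<gamma>' \<in> \<phi> ` \<Gamma>" for \<beta>' \<gamma>'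
      proof -
        obtain \<beta> \<gamma> where bc: "\<beta> \<in> \<Gamma>" "\<gamma> \<in> \<Gamma>" "\<beta>' = \<phi> \<beta>" "\<gamma>' = \<phi> \<gamma>" using \<open>\<beta>' \<in> _\<close> \<open>\<gamma>' \<in> _\<close> by blast
        have "\<phi> (\<lambda>i. \<beta> i + (1 + \<beta> y) * \<gamma> i) i = \<beta>' i + (1 + \<beta>' y) * \<gamma>' i" for i
        proof (cases "i = x")
          case True
          have "orbit_value (\<beta> x + (1 + \<beta> y) * \<gamma> x) = orbit_value (\<beta> x) + (1 + \<beta> y) * orbit_value (\<gamma> x)"
            using orbit_value_scale[OF chi0[OF bc(1)] scale[OF bc(1)]] by (simp add: orbit_value_additive)
          then show ?thesis using True bc \<phi>y by (simp add: \<phi>_def)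
        qed (use bc \<phi>y in \<open>simp add: \<phi>_def algebra_simps\<close>)
        then have "(\<lambda>i. \<beta>' i + (1 + \<beta>' y) * \<gamma>' i) = \<phi> (\<lambda>i. \<beta> i + (1 + \<beta> y) * \<gamma> i)" by presburger
        then show ?thesis using mul[OF bc(1,2)] by (rule image_eqI)
      qed
    qed
    moreover have "card (\<phi> ` \<Gamma>) < card \<Gamma>"
    proof -
      have "(\<lambda>_. 0) \<in> \<Gamma> - {\<theta>}" using \<theta>(3) G by (auto simp: affine_group_def)
      then have "\<phi> \<theta> \<in> \<phi> ` (\<Gamma> - {\<theta>})" using \<phi>0 \<phi>\<theta> by (metis imageI)
      then have "\<phi> ` \<Gamma> = \<phi> ` (\<Gamma> - {\<theta>})" by blast
      then have "card (\<phi> ` \<Gamma>) \<le> card (\<Gamma> - {\<theta>})"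
        using G by (simp add: affine_group_def card_image_le)
      also have "\<dots> < card \<Gamma>" using G \<theta>(1) by (intro card_Diff1_less) (simp_all add: affine_group_def)
      finally show ?thesis .
    qed
    moreover have "d' y = 1" using xy dy by (simp add: d'_def)
    moreover have "0 < d' i" for i using dpos card_A_pos by (simp add: d'_def)
    moreover have "(1 + \<beta> y) ^ d' i = 1 + \<beta> y" if "\<beta> \<in> \<phi> ` \<Gamma>" for \<beta> i
    proof -
      obtain \<gamma> where c: "\<gamma> \<in> \<Gamma>" "\<beta> = \<phi> \<gamma>" using \<open>\<beta> \<in> _\<close> by blast
      then show ?thesis
        using chi[OF c(1)] power_card_A[OF chi0[OF c(1)] scale[OF c(1)]]
        by (simp add: \<phi>y d'_def power_mult)
    qed
    ultimately obtain P where P: "basic_generators y d' (affine_invariants y d' (\<phi> ` \<Gamma>)) P"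
      using less.hyps[of "\<phi> ` \<Gamma>" d'] by blast
    have shear: "subst_poly (shear x y k c) N = N" if "x = y \<or> c y = 0" for k c
      using shear_y[of x y c k] that by (simp add: orbit_poly_def Y_def)
    have xy': "x = y \<or> u y = 0" using uy by simp
    note coords = line_coords[where x = x and y = y and u = u and d = d and M = N,
      OF xy' ux du shear N_inj dy, folded f_def]
    have "basic_generators y d (affine_invariants y d \<Gamma>) (\<lambda>i. subst_poly f (P i))"
    proof (rule basic_generators_pullback[OF P])
      show "subst_poly (affine_subst y d \<beta>) (f i) = subst_poly f (affine_subst y d' (\<phi> \<beta>) i)"
        if b: "\<beta> \<in> \<Gamma>" for \<beta> i
      proof -
        let ?c = "1 + \<beta> y"
        have ty: "subst_poly (affine_subst y d \<beta>) (Var y) = Const ?c * Var y"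
          by (simp add: affine_subst_def dy Const_add distrib_right)
        have ty_power: "subst_poly (affine_subst y d \<beta>) (Var y ^ k) = Const (?c ^ k) * Var y ^ k" for k
          by (simp only: subst_poly_power ty power_mult_distrib Const_power)
        show ?thesis
        proof (cases "i = x")
          case True
          have "subst_poly (affine_subst y d \<beta>) N = (\<Prod>a\<in>A. Var x + Const (\<beta> x + ?c * a) * Y)"
            using chi[OF b, of x] unfolding orbit_poly_def subst_poly_prod
            by (intro prod.cong refl)
              (simp add: Y_def ty_power Const_add Const_mult affine_subst_def algebra_simps del: subst_poly_power)
          \<comment> \<open>The determinant of \<open>\<beta>\<close> only permutes the factors, as it multiplies \<open>A\<close> onto itself.\<close>
          also have "\<dots> = (\<Prod>a\<in>A. Var x + Const (\<beta> x + a) * Y)"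
            using prod.reindex[OF scale_A(2)[OF chi0[OF b] scale[OF b], of A],
                where g = "\<lambda>a. Var x + Const (\<beta> x + a) * Y"] scale_A(1)[OF chi0[OF b] scale[OF b]]
            by (simp add: comp_def)
          also have "\<dots> = f x + Const (\<phi> \<beta> x) * Var y ^ d' x"
            unfolding N_additive by (simp add: fx \<phi>_def d'_def power_mult Y_def[symmetric])
          finally show ?thesis using True by (simp add: affine_subst_def fx fy)
        next
          case False
          have fi: "f i = Var i - Const (u i) * (Var y ^ (d i - d x) * Var x)"
            using False by (simp add: f_def line_coords_def mult.assoc)
          show ?thesis
          proof (cases "u i = 0")
            case True
            then show ?thesis using False by (simp add: fi affine_subst_def fy \<phi>_def d'_def)
          next
            case nz: False
            have "?c ^ (d i - d x) = 1"
              using power_diff_eq_1[OF chi0[OF b] chi[OF b, of x] chi[OF b, of i] du[OF nz]] .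
            then have "subst_poly (affine_subst y d \<beta>) (f i) = Var i + Const (\<beta> i) * Var y ^ d i
                - Const (u i) * (Var y ^ (d i - d x) * (Var x + Const (\<beta> x) * Var y ^ d x))"
              by (simp add: fi ty_power affine_subst_def del: subst_poly_power)
            also have "\<dots> = f i + Const (\<phi> \<beta> i) * Var y ^ d i"
            proof -
              have "(Var y ^ d i :: ('n, 'a) mpoly) = Var y ^ (d i - d x) * Var y ^ d x"
                using du[OF nz] by (simp flip: power_add)
              then show ?thesis
                using False by (simp add: fi \<phi>_def Const_diff Const_mult algebra_simps)
            qed
            finally show ?thesis using False by (simp add: affine_subst_def fy d'_def)
          qed
        qed
      qed
      show "inj (subst_poly f)" by (rule coords)
      show "affine_invariants y d \<Gamma> \<subseteq> range (subst_poly f)"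
      proof (rule coords(3)[of A])
        fix q assume "\<And>a. a \<in> A \<Longrightarrow> subst_poly (Var(x := Var x + Const a * Var y ^ d x)) q = q"
        then show "q \<in> range (subst_poly (Var(x := N)))"
          by (intro invariants_of_translations) (simp only: Y_def)
      qed (use xy in \<open>simp_all add: A_def\<close>)
      show "weighted_homog d (d' i) (f i)" for i
      proof -
        have "weighted_homog d (\<Sum>a\<in>A. d x) N"
          unfolding orbit_poly_def Y_def
        proof (intro weighted_homog_prod weighted_homog_add weighted_homog_Var weighted_homog_Const_mult)
          show "weighted_homog d (d x) (Var y ^ d x)" using weighted_homog_power[OF weighted_homog_Var[of d y], of "d x"] dy by simp
        qed
        then show ?thesis using coords(4)[of "d x * card A" i] by (auto simp: d'_def mult.commute)
      qed
      show "f y = Var y ^ 1" by (simp add: fy)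
      have Ey: "shear x y (\<lambda>i. d i - d x) (\<lambda>i. - u i) y = Var y"
        by (rule shear_y) (simp add: uy)
      have "jacobian f = subst_poly (shear x y (\<lambda>i. d i - d x) (\<lambda>i. - u i)) (partial_deriv x N)"
        by (rule coords(2))
      then show "jacobian f = Const (\<Prod>(A - {0})) * Var y ^ (d x * (card A - 1))"
        unfolding partial_deriv_N by (simp add: Y_def Ey flip: power_mult)
      show "\<Prod>(A - {0}) \<noteq> 0" using fin by simp
    qed
    then show ?thesis by blast
  qed
qed

section \<open>Comparing two systems of basic invariants\<close>

text \<open>
  Each system is polynomial in the other.  By algebraic independence of \<open>f\<close>, writing \<open>f\<close> in terms of \<open>g\<close>
  and then \<open>g\<close> in terms of \<open>f\<close> gives back the variables, so by the chain rule the Jacobian determinants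
  of the two transition maps multiply to \<open>1\<close>.
\<close>

lemma jacobian_generators_unit:
  assumes ind: "alg_independent f" and eq: "generated_algebra f = generated_algebra g"
  obtains u v where "u * v = 1" "jacobian f = u * jacobian g"
proof -
  have in_range: "h i \<in> generated_algebra h" for h :: "'a \<Rightarrow> ('c, 'b) mpoly" and i
    unfolding generated_algebra_def by (metis rangeI subst_poly_Var)
  have "\<forall>i. \<exists>q. g i = subst_poly f q" using in_range[of g] eq by (auto simp: generated_algebra_def)
  then obtain Q where Q: "\<And>i. g i = subst_poly f (Q i)" by metis
  have "\<forall>i. \<exists>q. f i = subst_poly g q" using in_range[of f] eq by (auto simp: generated_algebra_def)
  then obtain R where R: "\<And>i. f i = subst_poly g (R i)" by metis
  have gQ: "subst_poly g p = subst_poly f (subst_poly Q p)" for p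
    by (simp add: subst_poly_subst_poly flip: Q)
  have inj: "inj (subst_poly f)" using ind by (simp add: alg_independent_iff_inj)
  have "subst_poly f (subst_poly Q (R i)) = subst_poly f (Var i)" for i
    by (simp flip: gQ R)
  then have QR: "subst_poly Q (R i) = Var i" for i
    by (rule injD[OF inj])
  have "subst_poly Q (jacobian R) * jacobian Q = jacobian (\<lambda>i. subst_poly Q (R i))"
    by (rule jacobian_subst_poly[symmetric])
  also have "\<dots> = 1" by (simp add: QR)
  finally have "subst_poly f (subst_poly Q (jacobian R)) * subst_poly f (jacobian Q) = 1"
    by (metis subst_poly_mult subst_poly_one)
  moreover have "jacobian f = subst_poly g (jacobian R) * jacobian g"
    using jacobian_subst_poly[of g R] by (simp flip: R)
  ultimately show ?thesis using that gQ by metis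
qed

lemma lookup_Var_power_mult:
  "Poly_Mapping.lookup (Var y ^ m * p) (Poly_Mapping.single y m + e) = Poly_Mapping.lookup p e"
  by (induction p rule: mpoly_single_induct)
    (simp_all add: Var_power mult_single lookup_single when_def algebra_simps lookup_add)

text \<open>
  Division by \<open>Var y ^ m\<close> keeps homogeneity, and a homogeneous unit has degree \<open>0\<close> because the constant
  term of \<open>u * v\<close> comes from a monomial of \<open>u\<close> of degree \<open>0\<close>.
\<close>

lemma homogeneous_unit_mult_Var_power:
  fixes u v :: "('n::finite, 'a::field) mpoly"
  assumes hom: "weighted_homog (\<lambda>_. 1) s (Var y ^ m * u)" and unit: "u * v = 1"
  obtains c where "c \<noteq> 0" "u = Const c" "m = s"
proof -
  have deg: "(\<Sum>i\<in>UNIV. Poly_Mapping.lookup e i) + m = s" if e: "e \<in> Poly_Mapping.keys u" for e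
  proof -
    have "Poly_Mapping.single y m + e \<in> Poly_Mapping.keys (Var y ^ m * u)"
      using e by (simp add: in_keys_iff lookup_Var_power_mult)
    then have "(\<Sum>i\<in>UNIV. Poly_Mapping.lookup (Poly_Mapping.single y m + e) i) = s"
      using hom by (simp add: weighted_homog_def)
    then show ?thesis by (simp add: lookup_add sum.distrib lookup_single when_def add.commute)
  qed
  have "0 \<in> Poly_Mapping.keys (u * v)" by (simp add: unit)
  then obtain a b where ab: "0 = a + b" "a \<in> Poly_Mapping.keys u" using keys_mult[of u v] by blast
  have "Poly_Mapping.lookup a i = 0" for i
    using arg_cong[OF ab(1), of "\<lambda>e. Poly_Mapping.lookup e i"] by (simp add: lookup_add)
  then have ms: "m = s" using deg[OF ab(2)] by simp
  have "e = 0" if "e \<in> Poly_Mapping.keys u" for e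
    using deg[OF that] ms by (intro poly_mapping_eqI) simp
  then have "u = Const (Poly_Mapping.lookup u 0)"
    by (intro poly_mapping_eqI) (auto simp: Const_def lookup_single when_def in_keys_iff)
  moreover have "u \<noteq> 0" using unit by force
  ultimately show ?thesis using that[of "Poly_Mapping.lookup u 0"] ms by (metis Const_0)
qed

section \<open>Linear changes of coordinates\<close>

text \<open>
  The linear change of coordinates that replaces \<open>Var y\<close> by the linear form with coefficients \<open>a\<close>; it
  is invertible when that form involves \<open>Var y\<close>.
\<close>

definition linear_coords :: "'n::finite \<Rightarrow> ('n \<Rightarrow> 'a::field) \<Rightarrow> 'n \<Rightarrow> ('n, 'a) mpoly" where
  "linear_coords y a = Var(y := \<Sum>i\<in>UNIV. Const (a i) * Var i)"

definition linear_coords_inverse :: "'n::finite \<Rightarrow> ('n \<Rightarrow> 'a::field) \<Rightarrow> 'n \<Rightarrow> ('n, 'a) mpoly" where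
  "linear_coords_inverse y a =
     Var(y := Const (1 / a y) * (Var y - (\<Sum>i\<in>UNIV - {y}. Const (a i) * Var i)))"

lemma linear_form_split:
  "(\<Sum>i\<in>UNIV. Const (a i) * Var (i::'n::finite)) =
     Const (a y) * Var y + (\<Sum>i\<in>UNIV - {y}. Const (a i) * Var i)"
  by (rule sum.remove) simp_all

lemma subst_poly_linear_coords_inverse:
  fixes a :: "'n::finite \<Rightarrow> 'a::field"
  assumes "a y \<noteq> 0"
  shows "subst_poly (linear_coords y a) (subst_poly (linear_coords_inverse y a) p) = p"
    and "subst_poly (linear_coords_inverse y a) (subst_poly (linear_coords y a) p) = p"
proof -
  have rest: "(\<Sum>i\<in>UNIV - {y}. Const (a i) * subst_poly (Var(y := t)) (Var i)) =
      (\<Sum>i\<in>UNIV - {y}. Const (a i) * Var i)" for t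
    by (rule sum.cong) auto
  have "subst_poly (linear_coords y a) (linear_coords_inverse y a i) = Var i" for i
  proof (cases "i = y")
    case True
    have "Const (1 / a y) * (Const (a y) * Var y) = Var y"
      using assms by (simp flip: Const_mult mult.assoc)
    then show ?thesis
      using True rest by (simp add: linear_coords_def linear_coords_inverse_def linear_form_split[of a y])
  qed (simp add: linear_coords_def linear_coords_inverse_def)
  then show "subst_poly (linear_coords y a) (subst_poly (linear_coords_inverse y a) p) = p"
    by (simp add: subst_poly_subst_poly)
  have "subst_poly (linear_coords_inverse y a) (linear_coords y a i) = Var i" for i
  proof (cases "i = y")
    case True
    have "Const (a y) * (Const (1 / a y) * t) = t" for t :: "('n, 'a) mpoly"
      using assms by (simp flip: Const_mult mult.assoc)
    then show ?thesis
      using True rest by (simp add: linear_coords_def linear_coords_inverse_def linear_form_split[of a y])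
  qed (simp add: linear_coords_def linear_coords_inverse_def)
  then show "subst_poly (linear_coords_inverse y a) (subst_poly (linear_coords y a) p) = p"
    by (simp add: subst_poly_subst_poly)
qed

lemma jacobian_linear_coords: "jacobian (linear_coords y a) = Const (a y)"
proof -
  have "jacobian (linear_coords y a) = (\<Sum>i\<in>UNIV. if i = y then Const (a i) else 0)"
    unfolding linear_coords_def jacobian_upd partial_deriv_sum
    by (rule sum.cong) (simp_all add: partial_deriv_Var)
  then show ?thesis by simp
qed

lemma weighted_homog_linear_coords: "weighted_homog (\<lambda>_. 1) 1 (linear_coords y a i)"
proof -
  have "weighted_homog (\<lambda>_. 1) 1 (Var j :: ('a, 'b) mpoly)" for j using weighted_homog_Var[of "\<lambda>_. 1" j] by simp
  then show ?thesis
    by (auto simp: linear_coords_def simp del: One_nat_def intro!: weighted_homog_sum weighted_homog_Const_mult)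
qed

lemma weighted_homog_linear_coords_inverse: "weighted_homog (\<lambda>_. 1) 1 (linear_coords_inverse y a i)"
proof -
  have "weighted_homog (\<lambda>_. 1) 1 (Var j :: ('a, 'b) mpoly)" for j using weighted_homog_Var[of "\<lambda>_. 1" j] by simp
  then show ?thesis
    by (auto simp: linear_coords_inverse_def simp del: One_nat_def
        intro!: weighted_homog_sum weighted_homog_Const_mult weighted_homog_diff)
qed

section \<open>Linear groups fixing a hyperplane pointwise\<close>

locale hyperplane_fixing_group =
  fixes smul :: "'a::field \<Rightarrow> 'v::ab_group_add \<Rightarrow> 'v"
    and B H :: "'v set" and G :: "('v \<Rightarrow> 'v) set"
    and l :: "'v \<Rightarrow> 'a" and z :: "'n::finite \<Rightarrow> 'v \<Rightarrow> 'a"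
  assumes fdvs: "finite_dimensional_vector_space smul B"
    and basis: "dual_basis smul z"
    and hyp: "hyperplane smul H"
    and l: "l \<in> dual_space smul" and ker: "{v. l v = 0} = H"
    and subgroup: "subgroup G (GL smul)" and finG: "finite G"
    and fixH: "\<forall>g\<in>G. \<forall>v\<in>H. g v = v"
begin

sublocale V: finite_dimensional_vector_space smul B by (rule fdvs)

sublocale D: vector_space "fun_scale :: 'a \<Rightarrow> ('v \<Rightarrow> 'a) \<Rightarrow> 'v \<Rightarrow> 'a"
  by unfold_locales (auto simp: fun_scale_def fun_eq_iff algebra_simps)

lemma dual:
  assumes "\<phi> \<in> dual_space smul"
  shows dual_add: "\<phi> (v + w) = \<phi> v + \<phi> w" and dual_smul: "\<phi> (smul c v) = c * \<phi> v"
    and dual_diff: "\<phi> (v - w) = \<phi> v - \<phi> w"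
proof -
  interpret Vector_Spaces.linear smul "(*)" \<phi> using assms by (simp add: dual_space_def)
  show "\<phi> (v + w) = \<phi> v + \<phi> w" "\<phi> (smul c v) = c * \<phi> v" "\<phi> (v - w) = \<phi> v - \<phi> w"
    by (rule add scale diff)+
qed

lemma group_linear:
  assumes "g \<in> G"
  shows group_add: "g (v + w) = g v + g w" and group_smul: "g (smul c v) = smul c (g v)"
    and group_bij: "bij g"
proof -
  have g: "g \<in> carrier (GL smul)" using subgroup.mem_carrier[OF subgroup assms] .
  then interpret Vector_Spaces.linear smul smul g by (simp add: GL_def)
  show "g (v + w) = g v + g w" "g (smul c v) = smul c (g v)" by (rule add scale)+
  show "bij g" using g by (simp add: GL_def)
qed

lemma group_id: "id \<in> G"
  using subgroup.one_closed[OF subgroup] by (simp add: GL_def)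

lemma group_comp: "g \<in> G \<Longrightarrow> h \<in> G \<Longrightarrow> g \<circ> h \<in> G"
  using subgroup.m_closed[OF subgroup, of g h] by (simp add: GL_def)

text \<open>
  Right multiplication by \<open>g\<close> is injective on the finite set \<open>G\<close>, so it reaches the identity.
\<close>

lemma group_inv: 
  assumes g: "g \<in> G"
  shows "inv_into UNIV g \<in> G"
proof -
  have inj: "inj_on (\<lambda>h. h \<circ> g) G"
    using group_bij[OF g] by (intro inj_onI) (metis bij_is_surj surj_fun_eq fun_eq_iff comp_apply surjD)
  have "(\<lambda>h. h \<circ> g) ` G = G"
    using finG group_comp g by (intro card_subset_eq) (auto simp: card_image[OF inj])
  then obtain h where h: "h \<in> G" "h \<circ> g = id" using group_id by (metis (no_types, lifting) imageE)
  have "inv_into UNIV g = h"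
    using group_bij[OF g] h(2) by (metis bij_is_surj comp_id comp_assoc surj_iff id_comp)
  then show ?thesis using h by simp
qed

lemma exists_unit_vector: "\<exists>v. l v = 1"
proof -
  have "H \<noteq> UNIV" using hyp by (auto simp: hyperplane_def)
  then obtain v where v: "l v \<noteq> 0" using ker by blast
  then have "l (smul (1 / l v) v) = 1" by (simp add: dual_smul[OF l])
  then show ?thesis by blast
qed

definition v0 :: 'v where "v0 = (SOME v. l v = 1)"

definition shift :: "('v \<Rightarrow> 'v) \<Rightarrow> 'v" where "shift h = h v0 - v0"

lemma l_v0: "l v0 = 1"
  unfolding v0_def using exists_unit_vector by (rule someI_ex)

text \<open>
  The component of \<open>v\<close> in \<open>H\<close> is fixed, so the whole map is determined by the displacement of \<open>v0\<close>.
\<close>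

lemma group_apply:
  assumes h: "h \<in> G"
  shows "h v = v + smul (l v) (shift h)"
proof -
  have "l (v - smul (l v) v0) = 0" by (simp add: dual_diff[OF l] dual_smul[OF l] l_v0)
  then have "h (v - smul (l v) v0) = v - smul (l v) v0" using fixH h ker by blast
  moreover have "h (v - smul (l v) v0 + smul (l v) v0) = h (v - smul (l v) v0) + smul (l v) (h v0)"
    by (simp only: group_add[OF h] group_smul[OF h])
  ultimately show ?thesis by (simp add: shift_def V.scale_right_diff_distrib)
qed

lemma dual_comp:
  assumes "h \<in> G" "\<phi> \<in> dual_space smul"
  shows "\<phi> \<circ> h = \<phi> + fun_scale (\<phi> (shift h)) l"
  by (rule ext) (simp add: group_apply[OF assms(1)] dual_add[OF assms(2)] dual_smul[OF assms(2)] fun_scale_def)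

lemma shift_comp:
  assumes "g \<in> G" "h \<in> G"
  shows "shift (h \<circ> g) = shift g + smul (1 + l (shift g)) (shift h)"
proof -
  have "l (g v0) = 1 + l (shift g)" by (simp add: shift_def dual_diff[OF l] l_v0)
  then show ?thesis using group_apply[OF assms(2), of "g v0"] by (simp add: shift_def)
qed

text \<open>
  If \<open>h v0\<close> were in \<open>H\<close>, it would be fixed by \<open>h\<close>, and injectivity would put \<open>v0\<close> itself in \<open>H\<close>.
\<close>

lemma one_plus_l_shift: 
  assumes h: "h \<in> G"
  shows "1 + l (shift h) \<noteq> 0"
proof
  assume "1 + l (shift h) = 0"
  then have "l (h v0) = 0" by (simp add: shift_def dual_diff[OF l] l_v0)
  then have "h (h v0) = h v0" using fixH h ker by blast
  then have "h v0 = v0" using group_bij[OF h] by (metis bij_pointE)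
  then show False using \<open>l (h v0) = 0\<close> l_v0 by simp
qed

lemma independent: "D.independent (range z)" and inj_z: "inj z"
  and span: "D.span (range z) = dual_space smul"
  using basis by (simp_all add: dual_basis_def)

lemma z_dual: "z i \<in> dual_space smul"
  using D.span_base[of "z i" "range z"] span by simp

lemma linear_form_add:
  "\<phi> \<in> dual_space smul \<Longrightarrow> \<psi> \<in> dual_space smul \<Longrightarrow> linear_form z (\<phi> + \<psi>) = linear_form z \<phi> + linear_form z \<psi>"
  using D.representation_add[OF independent, of \<psi> \<phi>] span
  by (simp add: linear_form_def Const_add distrib_right sum.distrib)

lemma linear_form_scale:
  "\<phi> \<in> dual_space smul \<Longrightarrow> linear_form z (fun_scale c \<phi>) = Const c * linear_form z \<phi>"
  using D.representation_scale[OF independent, of \<phi> c] span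
  by (simp add: linear_form_def Const_mult mult.assoc sum_distrib_left)

lemma linear_form_z: "linear_form z (z i) = Var i"
proof -
  have "linear_form z (z i) = (\<Sum>j\<in>UNIV. if j = i then Var j else 0)"
    unfolding linear_form_def D.representation_basis[OF independent rangeI]
    by (rule sum.cong) (auto simp: inj_eq[OF inj_z])
  then show ?thesis by simp
qed

definition a :: "'n \<Rightarrow> 'a" where "a i = module.representation fun_scale (range z) l (z i)"

lemma linear_form_l: "linear_form z l = (\<Sum>i\<in>UNIV. Const (a i) * Var i)"
  by (simp add: linear_form_def a_def)

lemma l_eq_sum: "l v = (\<Sum>i\<in>UNIV. a i * z i v)"
proof -
  have "(\<Sum>b\<in>range z. fun_scale (D.representation (range z) l b) b) = l"
    by (rule D.sum_representation_eq) (use independent span l in auto)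
  then have "(\<Sum>i\<in>UNIV. fun_scale (a i) (z i)) = l"
    by (simp add: sum.reindex[OF inj_z] a_def)
  moreover have "(\<Sum>i\<in>I. fun_scale (a i) (z i)) v = (\<Sum>i\<in>I. a i * z i v)" for I
    by (induction I rule: infinite_finite_induct) (simp_all add: fun_scale_def)
  ultimately show ?thesis by metis
qed

lemma exists_coordinate: "\<exists>y. a y \<noteq> 0"
  using l_eq_sum[of v0] l_v0 by (metis (no_types, lifting) mult_zero_left sum.neutral zero_neq_one)

text \<open>
  A coordinate that \<open>l\<close> involves, and which \<open>l\<close> can therefore replace.
\<close>

definition y :: 'n where "y = (SOME y. a y \<noteq> 0)"

lemma a_y: "a y \<noteq> 0"
  unfolding y_def using exists_coordinate by (rule someI_ex)

definition \<Gamma> :: "('n \<Rightarrow> 'a) set" where "\<Gamma> = (\<lambda>h i. (z(y := l)) i (shift h)) ` G"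

lemma coords_dual: "(z(y := l)) i \<in> dual_space smul"
  by (simp add: z_dual l)

lemma affine_group_\<Gamma>: "affine_group y \<Gamma>"
  unfolding affine_group_def
proof (intro conjI ballI)
  show "finite \<Gamma>" using finG by (simp add: \<Gamma>_def)
  have "(\<lambda>_. 0) = (\<lambda>i. (z(y := l)) i (shift id))"
    using dual_diff[OF coords_dual, of _ v0 v0] by (simp add: shift_def del: fun_upd_apply)
  then show "(\<lambda>_. 0) \<in> \<Gamma>" using group_id unfolding \<Gamma>_def by (rule image_eqI)
  show "1 + \<beta> y \<noteq> 0" if "\<beta> \<in> \<Gamma>" for \<beta> using that one_plus_l_shift by (auto simp: \<Gamma>_def)
  show "(\<lambda>i. \<beta> i + (1 + \<beta> y) * \<gamma> i) \<in> \<Gamma>" if "\<beta> \<in> \<Gamma>" "\<gamma> \<in> \<Gamma>" for \<beta> \<gamma>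
  proof -
    obtain g h where gh: "g \<in> G" "h \<in> G" "\<beta> = (\<lambda>i. (z(y := l)) i (shift g))"
      "\<gamma> = (\<lambda>i. (z(y := l)) i (shift h))" using \<open>\<beta> \<in> \<Gamma>\<close> \<open>\<gamma> \<in> \<Gamma>\<close> by (auto simp: \<Gamma>_def simp del: fun_upd_apply)
    have "(\<lambda>i. \<beta> i + (1 + \<beta> y) * \<gamma> i) = (\<lambda>i. (z(y := l)) i (shift (h \<circ> g)))"
      unfolding gh(3,4) shift_comp[OF gh(1,2)] dual_add[OF coords_dual] dual_smul[OF coords_dual] by simp
    then show ?thesis using group_comp[OF gh(2,1)] unfolding \<Gamma>_def by (rule image_eqI)
  qed
qed

abbreviation "C \<equiv> linear_coords y a"

lemma C_y: "C y = linear_form z l"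
  by (simp add: linear_coords_def linear_form_l)

text \<open>
  In the coordinates where \<open>l\<close> plays the role of \<open>Var y\<close>, precomposition with \<open>h\<close> is the affine
  substitution of the displacement vector \<open>shift h\<close>.
\<close>

lemma act_coords:
  assumes h: "h \<in> G"
  shows "subst_poly (\<lambda>j. linear_form z (z j \<circ> h)) (C i) =
    subst_poly C (affine_subst y (\<lambda>_. 1) (\<lambda>i. (z(y := l)) i (shift h)) i)"
proof -
  have z: "linear_form z (z j \<circ> h) = Var j + Const (z j (shift h)) * C y" for j
  proof -
    have "fun_scale (z j (shift h)) l \<in> dual_space smul" using l span D.span_scale by metis
    then show ?thesis
      by (simp add: dual_comp[OF h z_dual] linear_form_add z_dual linear_form_scale l linear_form_z C_y)
  qed
  have "subst_poly (\<lambda>j. linear_form z (z j \<circ> h)) (C y) = C y + Const (l (shift h)) * C y"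
  proof -
    have "subst_poly (\<lambda>j. linear_form z (z j \<circ> h)) (C y) =
        (\<Sum>i\<in>UNIV. Const (a i) * Var i) + (\<Sum>i\<in>UNIV. Const (a i * z i (shift h))) * C y"
    proof -
      have "(\<Sum>i\<in>UNIV. Const (a i) * (Var i + Const (z i (shift h)) * t)) =
          (\<Sum>i\<in>UNIV. Const (a i) * Var i) + (\<Sum>i\<in>UNIV. Const (a i * z i (shift h))) * t" for t
        by (simp add: distrib_left sum.distrib Const_mult sum_distrib_right mult.assoc)
      then show ?thesis by (simp add: z) (simp add: C_y linear_form_l z)
    qed
    then show ?thesis by (simp add: l_eq_sum[of "shift h"] Const_sum C_y linear_form_l)
  qed
  then show ?thesis
    using z by (cases "i = y") (simp_all add: affine_subst_def linear_coords_def)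
qed

lemma inj_C: "inj (subst_poly C)"
  by (metis injI subst_poly_linear_coords_inverse(2) a_y)

text \<open>
  The action is by inverses, but \<open>g\<close> and its inverse both run through \<open>G\<close>.
\<close>

lemma invariant_ring_eq: "invariant_ring z G = subst_poly C ` affine_invariants y (\<lambda>_. 1) \<Gamma>"
proof -
  have iff: "subst_poly C q \<in> invariant_ring z G \<longleftrightarrow> q \<in> affine_invariants y (\<lambda>_. 1) \<Gamma>" for q
  proof -
    have "subst_poly C q \<in> invariant_ring z G \<longleftrightarrow>
        (\<forall>g\<in>G. subst_poly (\<lambda>j. linear_form z (z j \<circ> inv_into UNIV g)) (subst_poly C q) = subst_poly C q)"
      by (simp add: invariant_ring_def act_def)
    also have "\<dots> \<longleftrightarrow> (\<forall>h\<in>G. subst_poly (\<lambda>j. linear_form z (z j \<circ> h)) (subst_poly C q) = subst_poly C q)"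
      using group_inv inv_inv_eq[OF group_bij] by metis
    also have "\<dots> \<longleftrightarrow> (\<forall>h\<in>G. subst_poly (affine_subst y (\<lambda>_. 1) (\<lambda>i. (z(y := l)) i (shift h))) q = q)"
      using subst_poly_intertwine[OF act_coords] inj_C by (simp add: inj_eq del: fun_upd_apply)
    finally show ?thesis by (simp add: affine_invariants_def \<Gamma>_def del: fun_upd_apply)
  qed
  have onto: "p \<in> range (subst_poly C)" for p
    using subst_poly_linear_coords_inverse(1)[where y = y and a = a and p = p, OF a_y]
    by (rule range_eqI[OF sym])
  show ?thesis
  proof (intro subset_antisym subsetI)
    fix p assume p: "p \<in> invariant_ring z G"
    obtain q where q: "p = subst_poly C q" using onto[of p] by (rule rangeE)
    then have "q \<in> affine_invariants y (\<lambda>_. 1) \<Gamma>" using p iff[of q] by simp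
    then show "p \<in> subst_poly C ` affine_invariants y (\<lambda>_. 1) \<Gamma>" using q by (rule image_eqI[rotated])
  next
    fix p assume "p \<in> subst_poly C ` affine_invariants y (\<lambda>_. 1) \<Gamma>"
    then show "p \<in> invariant_ring z G" by (rule imageE) (simp add: iff)
  qed
qed

lemma exists_basic_invariants:
  obtains f c m where "basic_invariants z G f" "c \<noteq> 0" "jacobian f = Const c * linear_form z l ^ m"
proof -
  obtain P where P: "basic_generators y (\<lambda>_. 1) (affine_invariants y (\<lambda>_. 1) \<Gamma>) P"
    using affine_group_invariants[OF affine_group_\<Gamma>, of "\<lambda>_. 1"] by auto
  obtain c m where c: "c \<noteq> 0" "jacobian P = Const c * Var y ^ m" using P by (auto simp: basic_generators_def)
  define f where "f i = subst_poly C (P i)" for i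
  have comp: "subst_poly f = subst_poly C \<circ> subst_poly P"
    by (rule ext) (simp add: subst_poly_subst_poly f_def[abs_def])
  have "alg_independent f"
    unfolding alg_independent_iff_inj comp using P inj_C by (intro inj_compose) (simp_all add: basic_generators_def)
  moreover have "homogeneous (f i)" for i
  proof -
    obtain k where "weighted_homog (\<lambda>_. 1) k (P i)" using P by (auto simp: basic_generators_def)
    then have "weighted_homog (\<lambda>_. 1) k (f i)"
      unfolding f_def by (intro weighted_homog_subst_poly[where w' = "\<lambda>_. 1"] weighted_homog_linear_coords)
    then show ?thesis by (auto simp: homogeneous_iff_weighted_homog)
  qed
  moreover have "invariant_ring z G = generated_algebra f"
    unfolding generated_algebra_def comp image_comp[symmetric] invariant_ring_eq
    using P by (simp add: basic_generators_def)
  ultimately have "basic_invariants z G f" by (simp add: basic_invariants_def)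
  moreover have "jacobian f = Const (c * a y) * linear_form z l ^ m"
    unfolding f_def[abs_def] jacobian_subst_poly
    by (simp add: c jacobian_linear_coords C_y Const_mult mult_ac)
  moreover have "c * a y \<noteq> 0" using c a_y by simp
  ultimately show ?thesis using that by blast
qed

text \<open>
  The Jacobian of \<open>f\<close> is a unit \<open>u\<close> times the Jacobian of the generators constructed before, that is,
  times a power of \<open>l\<close>.  It is also homogeneous of degree the sum of the exponents, which makes \<open>u\<close> a
  constant and determines the power.
\<close>

lemma jacobian_basic_invariants:
  assumes f: "basic_invariants z G f"
  shows "jacobian f \<doteq> linear_form z l ^ (\<Sum>i\<in>UNIV. exponent_of (f i))"
proof -
  obtain g c m where g: "basic_invariants z G g" "c \<noteq> 0" "jacobian g = Const c * linear_form z l ^ m"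
    by (rule exists_basic_invariants)
  have "alg_independent f" "generated_algebra f = generated_algebra g"
    using f g(1) by (simp_all add: basic_invariants_def)
  then obtain u v where uv: "u * v = 1" "jacobian f = u * jacobian g"
    by (rule jacobian_generators_unit)
  let ?D = "subst_poly (linear_coords_inverse y a)"
  let ?s = "\<Sum>i\<in>UNIV. exponent_of (f i)"
  have "weighted_homog (\<lambda>_. 1) (total_degree (f i)) (f i)" for i
  proof (cases "f i = 0")
    case False
    obtain k where k: "weighted_homog (\<lambda>_. 1) k (f i)"
      using f by (auto simp: basic_invariants_def homogeneous_iff_weighted_homog)
    moreover obtain e where "e \<in> Poly_Mapping.keys (f i)" using False keys_eq_empty by blast
    ultimately have "monom_degree ` Poly_Mapping.keys (f i) = {k}"
      by (auto simp: weighted_homog_def monom_degree_def image_iff)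
    then show ?thesis using k False by (simp add: total_degree_def)
  qed simp
  then have "weighted_homog (\<lambda>_. 1) ?s (jacobian f)"
    unfolding exponent_of_def by (rule weighted_homog_jacobian)
  then have "weighted_homog (\<lambda>_. 1) ?s (?D (jacobian f))"
    by (intro weighted_homog_subst_poly[where w' = "\<lambda>_. 1"] weighted_homog_linear_coords_inverse)
  moreover have "?D (linear_form z l) = Var y"
    using subst_poly_linear_coords_inverse(2)[where y = y and a = a and p = "Var y", OF a_y] by (simp add: C_y)
  then have "?D (jacobian f) = Var y ^ m * (Const c * ?D u)"
    by (simp add: uv g mult_ac)
  moreover have "(Const c * ?D u) * (Const (1 / c) * ?D v) = 1"
  proof -
    have "(Const c * ?D u) * (Const (1 / c) * ?D v) = (Const c * Const (1 / c)) * (?D u * ?D v)"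
      by (simp only: mult_ac)
    moreover have "Const c * Const (1 / c) = (1 :: ('n, 'a) mpoly)"
      using g(2) by (simp flip: Const_mult)
    moreover have "?D u * ?D v = 1" using uv(1) by (metis subst_poly_mult subst_poly_one)
    ultimately show ?thesis by simp
  qed
  ultimately obtain c' where c': "c' \<noteq> 0" "Const c * ?D u = Const c'" "m = ?s"
    using homogeneous_unit_mult_Var_power by metis
  have "Const c * u = subst_poly C (?D (Const c * u))"
    by (simp only: subst_poly_linear_coords_inverse(1)[where y = y and a = a, OF a_y])
  also have "\<dots> = Const c'" using c'(2) by simp
  finally have "jacobian f = Const c' * linear_form z l ^ ?s"
    by (simp add: uv g c'(3) mult_ac flip: mult.assoc)
  then show ?thesis using c'(1) by (auto simp: eq_up_to_const_def)
qed

end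

theorem proposition3:
  fixes smul :: "'a::field \<Rightarrow> 'v::ab_group_add \<Rightarrow> 'v"
    and B H :: "'v set"
    and G :: "('v \<Rightarrow> 'v) set"
    and l :: "'v \<Rightarrow> 'a"
    and z :: "'n::finite \<Rightarrow> 'v \<Rightarrow> 'a"
  assumes "finite_dimensional_vector_space smul B"
    and "dual_basis smul z"
    and "hyperplane smul H"
    and "l \<in> dual_space smul" and "{v. l v = 0} = H"
    and "subgroup G (GL smul)" and "finite G"
    and "\<forall>g\<in>G. \<forall>v\<in>H. g v = v"
  shows "has_polynomial_invariants z G \<and>
    (\<forall>f. basic_invariants z G f \<longrightarrow>
       jacobian f \<doteq> linear_form z l ^ (\<Sum>i\<in>UNIV. exponent_of (f i)))"
proof -
  interpret hyperplane_fixing_group smul B H G l z by (rule hyperplane_fixing_group.intro) (fact assms)+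
  show ?thesis
    using exists_basic_invariants jacobian_basic_invariants
    by (auto simp: has_polynomial_invariants_def)
qed

end
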